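(* There is an absolute constant $C>0$ such that the following holds. Let $\epsilon\in(0,1)$, $\alpha\in(0,1]$, let $q$ be a prime power and let $A,M,L\subset\mathbb{F}_q^n$ with $\mu(A),\mu(M)\ge\alpha$. Then there is a subspace $V\le\mathbb{F}_q^n$ of codimension at most $C\epsilon^{-2}\log(2/\epsilon\alpha)^2\log(2/\alpha)^2$ such that \[ \left|1_A*1_M*1_L(x+t)-1_A*1_M*1_L(x)\right|\le\epsilon|A||M| \] for all $x\in\mathbb{F}_q^n$ and all $t\in V$. In particular \[ \left|1_A*1_M*1_L(0)-1_A*1_M*1_L*\mu_V(0)\right|\le\epsilon|A||M|. \]
   Context: For a set $X$ in $G=\mathbb{F}_q^n$, $\mu(X)=|X|/|G|$, $1_X$ is its indicator function and $\mu_X=1_X/|X|$. For $f,g:G\to\mathbb{C}$, $f*g(x)=\sum_{y\in G}f(y)g(x-y)$. *)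

theory Defs
  imports
    Complex_Main
    "HOL-Library.Indicator_Function"
    "HOL-Number_Theory.Prime_Powers"
    "HOL-Algebra.Weak_Morphisms"
    "Jordan_Normal_Form.Missing_VectorSpace"
begin

text \<open>
  A quantifier over types cannot occur inside a formula, so a constant that is to be independent
  of the finite field has to be followed by a quantifier over fields as values: these are taken
  to be records of type \<open>nat ring\<close>. Up to isomorphism this covers every finite field.
\<close>

lemma finite_field_iso_nat_ring:
  fixes K :: "'a ring"
  assumes "field K" "finite (carrier K)"
  shows "\<exists>F :: nat ring. field F \<and> K \<simeq> F"
proof -
  obtain h :: "'a \<Rightarrow> nat" where h: "inj_on h (carrier K)"
    using finite_imp_inj_to_nat_seg[OF assms(2)] by blast
  then have "h \<in> ring_iso K (image_ring h K)"
    by (rule inj_imp_image_ring_iso)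
  then show ?thesis
    using field.inj_imp_image_ring_is_field[OF assms(1) h] unfolding is_ring_iso_def by blast
qed

text \<open>
  The vector space \<open>F\<^sup>n\<close>; its vectors are functions on \<open>{..<n}\<close>, extended by
  \<^const>\<open>undefined\<close>.
\<close>

abbreviation coord_space :: "('a, 'b) ring_scheme \<Rightarrow> nat \<Rightarrow> ('a, nat \<Rightarrow> 'a) module"
  where "coord_space F n \<equiv> LinearCombinations.ring.func_space F {..<n}"

text \<open>Integer-valued, so that the subtraction cannot truncate.\<close>

definition codim ::
    "('a, 'b) ring_scheme \<Rightarrow> ('a, 'c, 'd) module_scheme \<Rightarrow> 'c set \<Rightarrow> int"
  where "codim K V W =
    int (vectorspace.dim K V) - int (vectorspace.dim K (V\<lparr>carrier := W\<rparr>))"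

definition density :: "('a, 'b) ring_scheme \<Rightarrow> 'a set \<Rightarrow> real"
  where "density G X = real (card X) / real (card (carrier G))"

definition convolution ::
    "('a, 'b) ring_scheme \<Rightarrow> ('a \<Rightarrow> complex) \<Rightarrow> ('a \<Rightarrow> complex) \<Rightarrow> 'a \<Rightarrow> complex"
  where "convolution G f g x = (\<Sum>y\<in>carrier G. f y * g (x \<ominus>\<^bsub>G\<^esub> y))"

abbreviation ind :: "'a set \<Rightarrow> 'a \<Rightarrow> complex"
  where "ind \<equiv> indicator"

definition uniform_weight :: "'a set \<Rightarrow> 'a \<Rightarrow> complex"
  where "uniform_weight X x = ind X x / of_nat (card X)"

end

theory Submission
  imports Defs "HOL-Algebra.Multiplicative_Group"
begin

text \<open>
  Write \<open>H = \<mu>\<^sub>A * \<mu>\<^sub>M * 1\<^sub>L\<close>. By Croot--Sisask sampling, for at least half of the \<open>k\<close>-tuples \<open>a\<close> in \<open>A\<^sup>k\<close>, with \<open>k\<close> of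
  order \<open>log(2/\<alpha>)/\<delta>\<^sup>2\<close>, the average of the translates of \<open>1\<^sub>L\<close> by the entries of \<open>a\<close> is close to
  \<open>\<mu>\<^sub>A * 1\<^sub>L\<close> in an exponential moment. Jensen's inequality turns this into closeness in mean on every
  translate of \<open>-M\<close>, because these sets have density at least \<open>\<alpha>\<close>. Some \<open>b\<close> in \<open>G\<^sup>k\<close> has
  \<open>\<alpha>\<^sup>k|G|/2\<close> diagonal translates among the good tuples, say by the set \<open>X\<close>, and then every element of
  \<open>X - X\<close> is a \<open>2\<delta>\<close>-almost period of \<open>H\<close> in the supremum norm.

  Convolving \<open>H\<close> with \<open>\<mu>\<^sub>X * \<mu>\<^bsub>-X\<^esub>\<close> for \<open>m\<close> times changes it by at most \<open>2m\<delta>\<close> and multiplies its Fourier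
  coefficients outside the \<open>1/2\<close>-spectrum of \<open>X\<close> by at most \<open>4\<^sup>-\<^sup>m\<close>, while by Parseval their sum is at
  most \<open>1/\<alpha>\<close>. By Chang's theorem the characters in the spectrum are trivial on a subspace of
  codimension \<open>O(log(|G|/|X|))\<close>. It remains to take \<open>m\<close> of order \<open>log(2/\<epsilon>\<alpha>)\<close> and \<open>\<delta> = \<epsilon>/8m\<close>.
\<close>

section \<open>Exponential moments and Croot--Sisask sampling\<close>

lemma exp_le_quadratic:
  fixes x :: real
  assumes "\<bar>x\<bar> \<le> 1"
  shows "exp x \<le> 1 + x + x\<^sup>2"
proof (cases "x \<ge> 0")
  case True
  with assms show ?thesis by (intro exp_bound) auto
next
  case False
  define y where "y = - x"
  have y: "0 \<le> y" "y \<le> 1" using False assms by (auto simp: y_def)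
  \<comment> \<open>With x = -y the claim reads 1 <= (1 - y + y^2) exp y. Replacing exp y by its
    quadratic Taylor polynomial leaves 1 plus nonnegative terms.\<close>
  have "1 + y + y\<^sup>2 / 2 \<le> exp y"
    using exp_lower_Taylor_quadratic[of y] y by simp
  moreover have "0 < 1 - y + y\<^sup>2"
    using y by (cases "y = 1") (auto intro: add_pos_nonneg)
  ultimately have "(1 - y + y\<^sup>2) * (1 + y + y\<^sup>2 / 2) \<le> (1 - y + y\<^sup>2) * exp y"
    by (intro mult_left_mono) auto
  moreover have "(1 - y + y\<^sup>2) * (1 + y + y\<^sup>2 / 2) = 1 + y ^ 2 / 2 + y ^ 3 / 2 + y ^ 4 / 2"
    by (simp add: field_simps power2_eq_square power3_eq_cube power4_eq_xxxx)
  ultimately have "1 \<le> (1 - y + y\<^sup>2) * exp y"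
    using y by (smt (verit) divide_nonneg_nonneg zero_le_power)
  then have "exp (- y) \<le> 1 - y + y\<^sup>2"
    by (simp add: exp_minus field_simps)
  then show ?thesis by (simp add: y_def)
qed

text \<open>In the quadratic bound for exp the linear terms sum to zero because \<open>Z\<close> has
  mean zero, and 1 + u^2 <= exp (u^2).\<close>

lemma sum_exp_mean_zero_le:
  fixes Z :: "'a \<Rightarrow> real"
  assumes "\<And>a. a \<in> A \<Longrightarrow> \<bar>Z a\<bar> \<le> 1" "sum Z A = 0" "\<bar>u\<bar> \<le> 1"
  shows "(\<Sum>a\<in>A. exp (u * Z a)) \<le> card A * exp (u\<^sup>2)"
proof -
  have "exp (u * Z a) \<le> 1 + u * Z a + u\<^sup>2" if "a \<in> A" for a
  proof -
    have "\<bar>u * Z a\<bar> \<le> 1"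
      using assms(1)[OF that] assms(3) by (simp add: abs_mult mult_le_one)
    then have "exp (u * Z a) \<le> 1 + u * Z a + (u * Z a)\<^sup>2"
      by (rule exp_le_quadratic)
    moreover have "(Z a)\<^sup>2 \<le> 1"
      using assms(1)[OF that] by (simp add: abs_square_le_1)
    then have "(u * Z a)\<^sup>2 \<le> u\<^sup>2"
      by (simp add: power_mult_distrib mult_left_le)
    ultimately show ?thesis by simp
  qed
  then have "(\<Sum>a\<in>A. exp (u * Z a)) \<le> (\<Sum>a\<in>A. 1 + u * Z a + u\<^sup>2)"
    by (rule sum_mono)
  also have "\<dots> = card A * (1 + u\<^sup>2)"
    using assms(2) by (simp add: sum.distrib flip: sum_distrib_left) (simp add: algebra_simps)
  also have "\<dots> \<le> card A * exp (u\<^sup>2)"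
    by (intro mult_left_mono) (auto simp: exp_ge_add_one_self)
  finally show ?thesis .
qed

text \<open>The tangent line of exp at the mean lies below exp, and its linear part averages to
  zero.\<close>

lemma jensen_exp:
  fixes f :: "'a \<Rightarrow> real"
  assumes "finite A" "A \<noteq> {}"
  shows "card A * exp ((\<Sum>a\<in>A. f a) / card A) \<le> (\<Sum>a\<in>A. exp (f a))"
proof -
  define c where "c = (\<Sum>a\<in>A. f a) / card A"
  have c: "(\<Sum>a\<in>A. f a) = card A * c"
    using assms by (simp add: c_def)
  have "exp c * (1 + (f a - c)) \<le> exp (f a)" for a
    using mult_left_mono[OF exp_ge_add_one_self[of "f a - c"], of "exp c"]
    by (simp flip: exp_add)
  then have "(\<Sum>a\<in>A. exp c * (1 + (f a - c))) \<le> (\<Sum>a\<in>A. exp (f a))"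
    by (intro sum_mono)
  also have "(\<Sum>a\<in>A. exp c * (1 + (f a - c))) = card A * exp c"
    by (simp add: sum.distrib sum_subtractf c flip: sum_distrib_left)
  finally show ?thesis by (simp add: c_def)
qed

text \<open>Independence of the coordinates: the exponential of the sum factors, so the sum over
  tuples is a k-th power.\<close>

lemma sum_exp_samples_le:
  fixes Z :: "'a \<Rightarrow> real"
  assumes "finite A" "\<And>a. a \<in> A \<Longrightarrow> \<bar>Z a\<bar> \<le> 1" "sum Z A = 0" "\<bar>u\<bar> \<le> 1"
  shows "(\<Sum>a \<in> {..<k} \<rightarrow>\<^sub>E A. exp (u * (\<Sum>i<k. Z (a i)))) \<le> card A ^ k * exp (k * u\<^sup>2)"
proof -
  have "(\<Sum>a \<in> {..<k} \<rightarrow>\<^sub>E A. exp (u * (\<Sum>i<k. Z (a i))))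
      = (\<Sum>a \<in> {..<k} \<rightarrow>\<^sub>E A. \<Prod>i<k. exp (u * Z (a i)))"
    by (simp add: exp_sum sum_distrib_left)
  also have "\<dots> = (\<Prod>i<k. \<Sum>a\<in>A. exp (u * Z a))"
    using assms(1) by (subst prod_sum_PiE) auto
  also have "\<dots> \<le> (card A * exp (u\<^sup>2)) ^ k"
    using sum_exp_mean_zero_le[OF assms(2-4)] by (simp add: power_mono sum_nonneg)
  also have "\<dots> = card A ^ k * exp (k * u\<^sup>2)"
    by (simp add: power_mult_distrib flip: exp_of_nat_mult)
  finally show ?thesis .
qed

text \<open>Jensen on \<open>W\<close>, followed by enlarging \<open>W\<close> to \<open>S\<close>,
  loses the factor 1/\<alpha> only inside a logarithm. The hypothesis \<open>exps\<close> does not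
  mention \<open>W\<close>, so one good sample serves all dense sets at once; this is what leads to
  a bound in the supremum norm. The 4 in \<open>exps\<close> is two signs times the factor 2 from
  Markov's inequality.\<close>

lemma sum_abs_le_of_exp_moment:
  fixes D :: "'a \<Rightarrow> real" and \<alpha> \<delta> :: real and k :: nat
  assumes S: "finite S" "W \<subseteq> S" "W \<noteq> {}" "\<alpha> * card S \<le> card W" "0 < \<alpha>" "\<alpha> \<le> 1"
    and \<delta>: "0 < \<delta>" and k: "0 < k" "8 * ln (2 / \<alpha>) / \<delta>\<^sup>2 \<le> real k"
    and exps: "(\<Sum>y\<in>S. exp (\<delta> / 2 * (k * D y)) + exp (- (\<delta> / 2) * (k * D y)))
      \<le> 4 * card S * exp (k * (\<delta> / 2)\<^sup>2)"
  shows "(\<Sum>y\<in>W. \<bar>D y\<bar>) \<le> \<delta> * card W"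
proof -
  define s where "s = \<delta> / 2 * k"
  define N where "N = (\<Sum>y\<in>W. \<bar>D y\<bar>)"
  have W: "finite W" "card W > 0"
    using S finite_subset by (auto simp: card_gt_0_iff)
  have s: "s > 0" using \<delta> k by (simp add: s_def)
  have "card W * exp (s * N / card W) = card W * exp ((\<Sum>y\<in>W. s * \<bar>D y\<bar>) / card W)"
    by (simp add: N_def sum_distrib_left)
  also have "\<dots> \<le> (\<Sum>y\<in>W. exp (s * \<bar>D y\<bar>))"
    using W S by (intro jensen_exp) auto
  also have "\<dots> \<le> (\<Sum>y\<in>W. exp (s * D y) + exp (- s * D y))"
    by (intro sum_mono) (auto simp: abs_if)
  also have "\<dots> \<le> (\<Sum>y\<in>S. exp (s * D y) + exp (- s * D y))"
    using S by (intro sum_mono2) (auto intro: add_nonneg_nonneg)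
  also have "\<dots> \<le> 4 * card S * exp (k * (\<delta> / 2)\<^sup>2)"
    using exps by (simp add: s_def mult.assoc)
  also have "\<dots> \<le> 4 * (card W / \<alpha>) * exp (k * (\<delta> / 2)\<^sup>2)"
    using S by (intro mult_right_mono mult_left_mono) (auto simp: field_simps)
  finally have "card W * exp (s * N / card W) \<le> card W * (4 / \<alpha> * exp (k * (\<delta> / 2)\<^sup>2))"
    by (simp add: field_simps)
  then have "exp (s * N / card W) \<le> 4 / \<alpha> * exp (k * (\<delta> / 2)\<^sup>2)"
    using W by (simp only: mult_le_cancel_left_pos of_nat_0_less_iff)
  also have "4 / \<alpha> \<le> (2 / \<alpha>)\<^sup>2"
    using S by (simp add: power2_eq_square field_simps)
  also have "(2 / \<alpha>)\<^sup>2 = exp (2 * ln (2 / \<alpha>))"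
    using S by (simp add: exp_double)
  finally have "exp (s * N / card W) \<le> exp (2 * ln (2 / \<alpha>) + k * (\<delta> / 2)\<^sup>2)"
    by (simp add: exp_add)
  then have "s * N / card W \<le> 2 * ln (2 / \<alpha>) + k * (\<delta> / 2)\<^sup>2"
    by simp
  \<comment> \<open>The lower bound on \<open>k\<close> is exactly 2 ln (2/\<alpha>) <= k \<delta>^2
    / 4; the two equal terms add up to \<open>s * \<delta>\<close>.\<close>
  also have "\<dots> \<le> k * \<delta>\<^sup>2 / 4 + k * (\<delta> / 2)\<^sup>2"
    using k \<delta> by (simp add: field_simps)
  also have "\<dots> = s * \<delta>"
    by (simp add: s_def power2_eq_square)
  finally have "s * (N / card W) \<le> s * \<delta>" by simp
  then have "N / card W \<le> \<delta>" using s by (simp only: mult_le_cancel_left_pos)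
  then show ?thesis using W by (simp add: N_def field_simps)
qed


section \<open>Translations in a finite abelian group and the sampling argument\<close>

locale finite_abelian_group = abelian_group G for G (structure) +
  assumes finite_carrier: "finite (carrier G)"
begin

lemma card_carrier_pos: "card (carrier G) > 0"
  using finite_carrier by (auto simp: card_gt_0_iff)

lemma card_pos_of_density:
  fixes \<alpha> :: real
  assumes "0 < \<alpha>" "\<alpha> * card (carrier G) \<le> card A"
  shows "card A > 0"
proof -
  have "0 < \<alpha> * card (carrier G)" using assms(1) card_carrier_pos by simp
  then show ?thesis using assms(2) by linarith
qed

lemma minus_add_cancel: "x \<in> carrier G \<Longrightarrow> t \<in> carrier G \<Longrightarrow> x \<ominus> t \<oplus> t = x"
  by (simp add: a_minus_def a_assoc l_neg)

lemma add_minus_cancel: "x \<in> carrier G \<Longrightarrow> t \<in> carrier G \<Longrightarrow> x \<oplus> t \<ominus> t = x"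
  by (simp add: a_minus_def a_assoc r_neg)

lemma bij_betw_add: "t \<in> carrier G \<Longrightarrow> bij_betw (\<lambda>x. x \<oplus> t) (carrier G) (carrier G)"
  by (rule bij_betw_byWitness[where f' = "\<lambda>x. x \<ominus> t"])
    (auto simp: minus_add_cancel add_minus_cancel)

lemma sum_translate:
  "t \<in> carrier G \<Longrightarrow> (\<Sum>x\<in>carrier G. f (x \<oplus> t)) = (\<Sum>x\<in>carrier G. f x)"
  using sum.reindex_bij_betw[OF bij_betw_add] .

lemma inj_on_minus_left: "x \<in> carrier G \<Longrightarrow> inj_on (\<lambda>y. x \<ominus> y) (carrier G)"
  by (rule inj_on_inverseI[where g = "\<lambda>y. x \<ominus> y"])
    (simp add: a_minus_def minus_add r_neg1 r_neg flip: a_assoc)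

text \<open>Double counting of the pairs (b, t) for which b shifted by -t lies in
  \<open>Good\<close>: every t admits at least |Good| tuples b, so some b among the |G|^k tuples has
  at least the average number of t.\<close>

lemma exists_diagonal_translates:
  assumes Good: "Good \<subseteq> {..<k} \<rightarrow>\<^sub>E carrier G"
  obtains b where "b \<in> {..<k} \<rightarrow>\<^sub>E carrier G"
    "card Good * card (carrier G)
      \<le> card {t \<in> carrier G. (\<lambda>i\<in>{..<k}. b i \<ominus> t) \<in> Good} * card (carrier G) ^ k"
proof (rule ccontr)
  let ?B = "{..<k} \<rightarrow>\<^sub>E carrier G"
  let ?X = "\<lambda>b. {t \<in> carrier G. (\<lambda>i\<in>{..<k}. b i \<ominus> t) \<in> Good}"
  assume "\<not> thesis"
  with that have less: "\<And>b. b \<in> ?B \<Longrightarrow> card (?X b) * card (carrier G) ^ k < card Good * card (carrier G)"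
    by (meson not_le)
  have B: "finite ?B" "card ?B = card (carrier G) ^ k"
    using finite_carrier by (auto simp: finite_PiE card_PiE)
  have GoodD: "a i \<in> carrier G" if "a \<in> Good" "i < k" for a i
    using that Good by (auto dest: PiE_mem)
  have translate: "(\<lambda>i\<in>{..<k}. a i \<oplus> t) \<in> ?B"
      "(\<lambda>i\<in>{..<k}. (\<lambda>i\<in>{..<k}. a i \<oplus> t) i \<ominus> t) = a" if a: "a \<in> Good" and t: "t \<in> carrier G" for a t
  proof -
    show "(\<lambda>i\<in>{..<k}. a i \<oplus> t) \<in> ?B"
      using GoodD[OF a] t by (intro restrict_PiE_iff[THEN iffD2]) auto
    have aB: "a \<in> ?B" using a Good by blast
    show "(\<lambda>i\<in>{..<k}. (\<lambda>i\<in>{..<k}. a i \<oplus> t) i \<ominus> t) = a"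
    proof
      fix i show "(\<lambda>i\<in>{..<k}. (\<lambda>i\<in>{..<k}. a i \<oplus> t) i \<ominus> t) i = a i"
        using GoodD[OF a, of i] t PiE_arb[OF aB, of i] by (simp add: add_minus_cancel)
    qed
  qed
  have "card Good \<le> card {b \<in> ?B. (\<lambda>i\<in>{..<k}. b i \<ominus> t) \<in> Good}" if t: "t \<in> carrier G" for t
  proof (rule card_inj_on_le)
    show "inj_on (\<lambda>a. \<lambda>i\<in>{..<k}. a i \<oplus> t) Good"
      by (rule inj_on_inverseI) (rule translate(2)[OF _ t])
    show "(\<lambda>a. \<lambda>i\<in>{..<k}. a i \<oplus> t) ` Good \<subseteq> {b \<in> ?B. (\<lambda>i\<in>{..<k}. b i \<ominus> t) \<in> Good}"
    proof (rule image_subsetI)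
      fix a assume a: "a \<in> Good"
      show "(\<lambda>i\<in>{..<k}. a i \<oplus> t) \<in> {b \<in> ?B. (\<lambda>i\<in>{..<k}. b i \<ominus> t) \<in> Good}"
        unfolding mem_Collect_eq translate(2)[OF a t] using translate(1)[OF a t] a by (rule conjI)
    qed
  qed (use B in auto)
  then have "(\<Sum>t\<in>carrier G. card Good)
      \<le> (\<Sum>t\<in>carrier G. card {b \<in> ?B. (\<lambda>i\<in>{..<k}. b i \<ominus> t) \<in> Good})"
    by (rule sum_mono)
  also have "\<dots> = (\<Sum>b\<in>?B. card (?X b))"
    using finite_carrier B(1) by (rule sum_multicount_gen) simp
  finally have "card (carrier G) * card Good * card (carrier G) ^ k
      \<le> (\<Sum>b\<in>?B. card (?X b) * card (carrier G) ^ k)"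
    by (simp flip: sum_distrib_right)
  also have "\<dots> < (\<Sum>b\<in>?B. card Good * card (carrier G))"
    using B less card_carrier_pos
    by (intro sum_strict_mono) (auto simp: PiE_eq_empty_iff)
  also have "\<dots> = card (carrier G) * card Good * card (carrier G) ^ k"
    using B by simp
  finally show False by simp
qed


text \<open>Let \<open>U\<close> be \<open>H\<close> with the average over \<open>A\<close> replaced
  by the average over a single tuple b. For every t in \<open>X\<close> the tuple b shifted by -t is
  a good sample, so U (x + t) is within \<delta> of H x, uniformly in x. Two shifts s and t are then
  compared through the common value U (x + s).\<close>

lemma croot_sisask:
  fixes f :: "'a \<Rightarrow> real" and \<alpha> \<delta> :: real and k :: nat
  assumes f: "\<And>x. x \<in> carrier G \<Longrightarrow> 0 \<le> f x \<and> f x \<le> 1"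
    and A: "A \<subseteq> carrier G" "\<alpha> * card (carrier G) \<le> card A"
    and M: "M \<subseteq> carrier G" "\<alpha> * card (carrier G) \<le> card M"
    and \<alpha>: "0 < \<alpha>" "\<alpha> \<le> 1" and \<delta>: "0 < \<delta>" "\<delta> \<le> 1"
    and k: "0 < k" "8 * ln (2 / \<alpha>) / \<delta>\<^sup>2 \<le> real k"
  defines "H \<equiv> \<lambda>x. (\<Sum>m\<in>M. (\<Sum>a\<in>A. f (x \<ominus> m \<ominus> a)) / card A) / card M"
  obtains X where "X \<subseteq> carrier G" "\<alpha> ^ k * card (carrier G) \<le> 2 * card X"
    "\<And>x s t. x \<in> carrier G \<Longrightarrow> s \<in> X \<Longrightarrow> t \<in> X \<Longrightarrow> \<bar>H (x \<oplus> s \<ominus> t) - H x\<bar> \<le> 2 * \<delta>"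
proof -
  let ?N = "card (carrier G)"
  let ?P = "{..<k} \<rightarrow>\<^sub>E A"
  let ?E = "exp (k * (\<delta> / 2)\<^sup>2)"
  define h where "h x = (\<Sum>a\<in>A. f (x \<ominus> a)) / card A" for x
  define Z where "Z x a = f (x \<ominus> a) - h x" for x a
  define D where "D a x = (\<Sum>i<k. Z x (a i)) / k" for a x
  have finA: "finite A" "finite M"
    using A M finite_carrier by (auto intro: finite_subset)
  have cardAM: "card A > 0" "card M > 0"
    using card_pos_of_density[OF \<alpha>(1)] A(2) M(2) by blast+
  have Z: "\<bar>Z x a\<bar> \<le> 1" if "x \<in> carrier G" "a \<in> A" for x a
  proof -
    have fx: "0 \<le> f (x \<ominus> a) \<and> f (x \<ominus> a) \<le> 1" if "a \<in> A" for a
      using that \<open>x \<in> carrier G\<close> A by (intro f) auto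
    have "0 \<le> (\<Sum>a\<in>A. f (x \<ominus> a))" "(\<Sum>a\<in>A. f (x \<ominus> a)) \<le> card A"
      using fx sum_mono[of A "\<lambda>a. f (x \<ominus> a)" "\<lambda>_. 1"] by (auto intro: sum_nonneg)
    then have "0 \<le> h x" "h x \<le> 1" using cardAM by (auto simp: h_def)
    then show ?thesis using fx[OF \<open>a \<in> A\<close>] by (auto simp: Z_def)
  qed
  have sumZ: "sum (Z x) A = 0" for x
    using cardAM by (simp add: Z_def sum_subtractf h_def)
  \<comment> \<open>The exponential moment, with both signs, of the sampling error of the tuple a
    over the whole group.\<close>
  define F where "F a = (\<Sum>x\<in>carrier G. exp (\<delta> / 2 * (k * D a x)) + exp (- (\<delta> / 2) * (k * D a x)))" for a
  have F_pos: "0 \<le> F a" for a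
    unfolding F_def by (intro sum_nonneg) (auto intro: add_nonneg_nonneg)
  define Good where "Good = {a \<in> ?P. F a \<le> 4 * real ?N * ?E}"
  have GoodD: "F a \<le> 4 * real ?N * ?E" if "a \<in> Good" for a
    using that by (simp add: Good_def)
  have P: "finite ?P" "card ?P = card A ^ k"
    using finA by (auto simp: finite_PiE card_PiE)
  have "(\<Sum>a\<in>?P. F a) = (\<Sum>x\<in>carrier G. \<Sum>a\<in>?P. exp (\<delta> / 2 * (k * D a x)) + exp (- (\<delta> / 2) * (k * D a x)))"
    unfolding F_def by (rule sum.swap)
  also have "\<dots> \<le> (\<Sum>x\<in>carrier G. 2 * (card A ^ k * ?E))"
  proof (rule sum_mono)
    fix x assume x: "x \<in> carrier G"
    have "(\<Sum>a\<in>?P. exp (u * (k * D a x))) \<le> card A ^ k * exp (k * u\<^sup>2)" if "\<bar>u\<bar> \<le> 1" for u :: real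
      using sum_exp_samples_le[OF finA(1) Z[OF x] sumZ that] k by (simp add: D_def)
    from this[of "\<delta> / 2"] this[of "- (\<delta> / 2)"] show "(\<Sum>a\<in>?P. exp (\<delta> / 2 * (k * D a x))
        + exp (- (\<delta> / 2) * (k * D a x))) \<le> 2 * (card A ^ k * ?E)"
      using \<delta> by (simp add: sum.distrib)
  qed
  finally have sumF: "(\<Sum>a\<in>?P. F a) \<le> 2 * ?N * ?E * card A ^ k" by (simp add: mult_ac)
  \<comment> \<open>Markov's inequality: the threshold in \<open>Good\<close> is twice the mean
    bound given by \<open>sumF\<close>, so at most half of the tuples are bad.\<close>
  have "card (?P - Good) * (4 * real ?N * ?E) \<le> (\<Sum>a\<in>?P - Good. F a)"
    by (rule sum_bounded_below) (use linear in \<open>auto simp: Good_def\<close>)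
  also have "\<dots> \<le> (\<Sum>a\<in>?P. F a)"
    using P F_pos by (intro sum_mono2) auto
  also note sumF
  finally have "(2 * real ?N * ?E) * (2 * real (card (?P - Good))) \<le> (2 * real ?N * ?E) * real (card A ^ k)"
    by (simp add: mult_ac)
  then have "2 * real (card (?P - Good)) \<le> card A ^ k"
    using card_carrier_pos by (subst (asm) mult_le_cancel_left_pos) auto
  moreover have "card (?P - Good) + card Good = card A ^ k"
  proof -
    have "Good \<subseteq> ?P" by (auto simp: Good_def)
    moreover from this have "finite Good" "card Good \<le> card ?P"
      using P finite_subset card_mono by blast+
    ultimately show ?thesis using P(2) by (simp only: card_Diff_subset)
  qed
  ultimately have half: "card A ^ k \<le> 2 * real (card Good)"
    by (smt (verit, best) of_nat_add)
  have "Good \<subseteq> {..<k} \<rightarrow>\<^sub>E carrier G"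
  proof -
    have "?P \<subseteq> {..<k} \<rightarrow>\<^sub>E carrier G" using A by (intro PiE_mono) blast
    moreover have "Good \<subseteq> ?P" by (auto simp: Good_def)
    ultimately show ?thesis by blast
  qed
  from exists_diagonal_translates[OF this] obtain b where b: "b \<in> {..<k} \<rightarrow>\<^sub>E carrier G" and
    many: "card Good * ?N \<le> card {t \<in> carrier G. (\<lambda>i\<in>{..<k}. b i \<ominus> t) \<in> Good} * ?N ^ k"
    by blast
  define X where "X = {t \<in> carrier G. (\<lambda>i\<in>{..<k}. b i \<ominus> t) \<in> Good}"
  define u where "u y = (\<Sum>i<k. f (y \<ominus> b i)) / k" for y
  define U where "U x = (\<Sum>m\<in>M. u (x \<ominus> m)) / card M" for x
  have near: "\<bar>U (x \<oplus> t) - H x\<bar> \<le> \<delta>" if x: "x \<in> carrier G" and t: "t \<in> X" for x t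
  proof -
    let ?a = "\<lambda>i\<in>{..<k}. b i \<ominus> t"
    \<comment> \<open>The difference U (x + t) - H x is the mean of the sampling error over x - M, a
      set of the same density as \<open>M\<close>.\<close>
    let ?W = "(\<lambda>m. x \<ominus> m) ` M"
    have t': "t \<in> carrier G" and a: "?a \<in> Good" using t by (auto simp: X_def)
    have inj: "inj_on (\<lambda>m. x \<ominus> m) M"
      using inj_on_subset[OF inj_on_minus_left[OF x] M(1)] .
    \<comment> \<open>Shifting the sample by -t amounts to evaluating its average at y + t.\<close>
    have D: "D ?a y = u (y \<oplus> t) - h y" if y: "y \<in> carrier G" for y
    proof -
      have "y \<ominus> (b i \<ominus> t) = y \<oplus> t \<ominus> b i" if "i < k" for i
      proof -
        have "b i \<in> carrier G" using PiE_mem[OF b] that by simp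
        then show ?thesis using y t' by (simp add: a_minus_def minus_add a_ac)
      qed
      then have "(\<Sum>i<k. Z y (?a i)) = (\<Sum>i<k. f (y \<oplus> t \<ominus> b i) - h y)"
        by (intro sum.cong) (simp_all add: Z_def)
      then show ?thesis using k by (simp add: D_def u_def sum_subtractf diff_divide_distrib)
    qed
    have "(\<Sum>y\<in>?W. \<bar>D ?a y\<bar>) \<le> \<delta> * card ?W"
    proof (rule sum_abs_le_of_exp_moment[where S = "carrier G" and k = k and \<alpha> = \<alpha>])
      show "?W \<noteq> {}" using cardAM by auto
      show "?W \<subseteq> carrier G" using x M by auto
      show "\<alpha> * ?N \<le> card ?W" using M inj by (simp add: card_image)
      show "(\<Sum>y\<in>carrier G. exp (\<delta> / 2 * (k * D ?a y)) + exp (- (\<delta> / 2) * (k * D ?a y))) \<le> 4 * ?N * ?E"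
        using GoodD[OF a] unfolding F_def by simp
    qed (use finite_carrier \<alpha> \<delta> k in auto)
    then have *: "(\<Sum>m\<in>M. \<bar>D ?a (x \<ominus> m)\<bar>) \<le> \<delta> * card M"
      using inj by (simp add: sum.reindex card_image)
    have "U (x \<oplus> t) - H x = (\<Sum>m\<in>M. D ?a (x \<ominus> m)) / card M"
    proof -
      have "x \<oplus> t \<ominus> m = x \<ominus> m \<oplus> t" if "m \<in> M" for m
        using x t' M that by (auto simp: a_minus_def a_ac)
      then have "D ?a (x \<ominus> m) = u (x \<oplus> t \<ominus> m) - h (x \<ominus> m)" if "m \<in> M" for m
        using x M that by (subst D) auto
      then show ?thesis
        by (simp add: U_def H_def sum_subtractf diff_divide_distrib flip: h_def)
    qed
    then have "\<bar>U (x \<oplus> t) - H x\<bar> \<le> (\<Sum>m\<in>M. \<bar>D ?a (x \<ominus> m)\<bar>) / card M"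
      by (simp add: divide_right_mono)
    also have "\<dots> \<le> \<delta>" using * cardAM by (simp add: field_simps)
    finally show ?thesis .
  qed
  show thesis
  proof (rule that)
    show "X \<subseteq> carrier G" by (auto simp: X_def)
    have "(\<alpha> ^ k * ?N) * real ?N ^ k = (\<alpha> * ?N) ^ k * ?N"
      by (simp add: power_mult_distrib)
    also have "\<dots> \<le> real (card A) ^ k * ?N"
      using A \<alpha> by (intro mult_right_mono power_mono) auto
    also have "\<dots> \<le> 2 * real (card Good * ?N)"
      using half by (simp add: mult_right_mono flip: mult.assoc)
    also have "\<dots> \<le> 2 * real (card X * ?N ^ k)"
      using of_nat_mono[OF many, where 'a = real, folded X_def] by linarith
    finally have "(\<alpha> ^ k * ?N) * real ?N ^ k \<le> (2 * card X) * real ?N ^ k" by simp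
    then show "\<alpha> ^ k * ?N \<le> 2 * card X"
      using card_carrier_pos by (subst (asm) mult_le_cancel_right_pos) auto
  next
    fix x s t assume *: "x \<in> carrier G" "s \<in> X" "t \<in> X"
    then have c: "s \<in> carrier G" "t \<in> carrier G" by (auto simp: X_def)
    have "\<bar>U (x \<oplus> s) - H x\<bar> \<le> \<delta>" using near * by blast
    \<comment> \<open>Since x + s - t + t = x + s, both estimates involve the same value of
      \<open>U\<close>.\<close>
    moreover have "\<bar>U (x \<oplus> s \<ominus> t \<oplus> t) - H (x \<oplus> s \<ominus> t)\<bar> \<le> \<delta>" using near * c by auto
    ultimately show "\<bar>H (x \<oplus> s \<ominus> t) - H x\<bar> \<le> 2 * \<delta>"
      using * c by (simp add: minus_add_cancel)
  qed
qed

end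

section \<open>Fourier expansion and almost periods\<close>

lemma cmod_average2_le:
  fixes d :: "'a \<Rightarrow> 'a \<Rightarrow> complex"
  assumes "finite X" "X \<noteq> {}" "\<And>s t. s \<in> X \<Longrightarrow> t \<in> X \<Longrightarrow> cmod (d s t) \<le> \<eta>"
  shows "cmod ((\<Sum>s\<in>X. \<Sum>t\<in>X. d s t) / (of_nat (card X))\<^sup>2) \<le> \<eta>"
proof -
  have "cmod (\<Sum>s\<in>X. \<Sum>t\<in>X. d s t) \<le> (\<Sum>s\<in>X. \<Sum>t\<in>X. \<eta>)"
    using assms(3) by (intro sum_norm_le) auto
  also have "\<dots> = (real (card X))\<^sup>2 * \<eta>" by (simp add: power2_eq_square)
  finally show ?thesis
    using assms(1,2) by (simp add: norm_divide norm_power field_simps card_gt_0_iff)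
qed

definition (in abelian_group) is_character :: "('a \<Rightarrow> complex) \<Rightarrow> bool"
  where "is_character \<chi> \<longleftrightarrow>
    (\<forall>x\<in>carrier G. \<forall>y\<in>carrier G. \<chi> (x \<oplus> y) = \<chi> x * \<chi> y) \<and> (\<forall>x\<in>carrier G. cmod (\<chi> x) = 1)"

section \<open>Characters of an abelian group\<close>

context abelian_group
begin

lemma minus_eq_zero_iff: "x \<in> carrier G \<Longrightarrow> y \<in> carrier G \<Longrightarrow> x \<ominus> y = \<zero> \<longleftrightarrow> x = y"
proof
  assume xy: "x \<in> carrier G" "y \<in> carrier G" and "x \<ominus> y = \<zero>"
  moreover have "x \<ominus> y \<oplus> y = x" using xy by (simp add: a_minus_def a_assoc l_neg)
  ultimately show "x = y" by simp
qed (simp add: a_minus_def r_neg)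

lemma character_add:
  "is_character \<chi> \<Longrightarrow> x \<in> carrier G \<Longrightarrow> y \<in> carrier G \<Longrightarrow> \<chi> (x \<oplus> y) = \<chi> x * \<chi> y"
  by (simp add: is_character_def)

lemma norm_character: "is_character \<chi> \<Longrightarrow> x \<in> carrier G \<Longrightarrow> cmod (\<chi> x) = 1"
  by (simp add: is_character_def)

lemma character_zero: "is_character \<chi> \<Longrightarrow> \<chi> \<zero> = 1"
  using character_add[of \<chi> \<zero> \<zero>] norm_character[of \<chi> \<zero>] by auto

lemma character_minus:
  assumes "is_character \<chi>" "x \<in> carrier G" "y \<in> carrier G"
  shows "\<chi> (x \<ominus> y) = \<chi> x * cnj (\<chi> y)"
proof -
  have "x \<ominus> y \<oplus> y = x" using assms by (simp add: a_minus_def a_assoc l_neg)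
  then have eq: "\<chi> (x \<ominus> y) * \<chi> y = \<chi> x"
    using character_add[of \<chi> "x \<ominus> y" y] assms by simp
  have unit: "\<chi> y * cnj (\<chi> y) = 1"
    using complex_norm_square[of "\<chi> y"] assms by (simp add: norm_character)
  have "\<chi> (x \<ominus> y) * (\<chi> y * cnj (\<chi> y)) = \<chi> x * cnj (\<chi> y)"
    by (simp only: mult.assoc[symmetric] eq)
  then show ?thesis using unit by simp
qed

end

section \<open>Repeated averaging over differences, Parseval and Fourier expansion\<close>

context finite_abelian_group
begin

text \<open>Makes the Fourier multiplier of averaging over X - X real and nonnegative, so that its
  powers can be bounded.\<close>

lemma sum_characters_differences:
  assumes "is_character \<chi>" "X \<subseteq> carrier G"
  shows "(\<Sum>s\<in>X. \<Sum>t\<in>X. \<chi> (s \<ominus> t)) = (of_real (cmod (\<Sum>s\<in>X. \<chi> s)))\<^sup>2"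
proof -
  have "(\<Sum>s\<in>X. \<Sum>t\<in>X. \<chi> (s \<ominus> t)) = (\<Sum>s\<in>X. \<Sum>t\<in>X. \<chi> s * cnj (\<chi> t))"
    using assms by (intro sum.cong) (auto simp: character_minus subset_iff)
  also have "\<dots> = (\<Sum>s\<in>X. \<chi> s) * cnj (\<Sum>s\<in>X. \<chi> s)"
    by (simp add: sum_product)
  finally show ?thesis by (simp only: complex_norm_square[symmetric] of_real_power)
qed

text \<open>
  Convolving \<open>H\<close> repeatedly with the uniform measure on \<open>X - X\<close> moves it by at most \<open>\<eta>\<close> each time
  and multiplies its Fourier coefficients by \<open>w i\<close>.
\<close>

lemma almost_period_annihilator:
  fixes c :: "'i \<Rightarrow> complex"
  assumes ch: "\<And>i. i \<in> I \<Longrightarrow> is_character (ch i)"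
    and B: "(\<Sum>i\<in>I. cmod (c i)) \<le> B"
    and X: "X \<subseteq> carrier G" "X \<noteq> {}"
    and H: "\<And>x. x \<in> carrier G \<Longrightarrow> H x = (\<Sum>i\<in>I. c i * ch i x)"
    and \<eta>: "\<And>x s t. x \<in> carrier G \<Longrightarrow> s \<in> X \<Longrightarrow> t \<in> X \<Longrightarrow> cmod (H (x \<oplus> s \<ominus> t) - H x) \<le> \<eta>"
    and t: "t \<in> carrier G"
      "\<And>i. i \<in> I \<Longrightarrow> cmod (\<Sum>x\<in>X. ch i x) \<ge> card X / 2 \<Longrightarrow> ch i t = 1"
    and x: "x \<in> carrier G"
  shows "cmod (H (x \<oplus> t) - H x) \<le> 2 * real m * \<eta> + 2 * B * (1 / 4) ^ m"
proof -
  have finX: "finite X" using X finite_carrier finite_subset by blast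
  then have cX: "card X > 0" using X by (simp add: card_gt_0_iff)
  \<comment> \<open>The multiplier of one averaging on \<open>ch i\<close>; it is below 1/4 outside
    the 1/2-spectrum of \<open>X\<close>. Below, \<open>P j\<close> is \<open>H\<close> averaged j
    times.\<close>
  define w where "w i = (cmod (\<Sum>x\<in>X. ch i x) / card X)\<^sup>2" for i
  define P where "P j x = (\<Sum>i\<in>I. c i * of_real (w i) ^ j * ch i x)" for j x
  have Xc: "s \<in> carrier G" if "s \<in> X" for s using that X by blast
  have step: "P (Suc j) y = (\<Sum>s\<in>X. \<Sum>t\<in>X. P j (y \<oplus> s \<ominus> t)) / (of_nat (card X))\<^sup>2"
    if y: "y \<in> carrier G" for j y
  proof -
    have "(\<Sum>s\<in>X. \<Sum>t\<in>X. P j (y \<oplus> s \<ominus> t))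
        = (\<Sum>i\<in>I. \<Sum>s\<in>X. \<Sum>t\<in>X. c i * of_real (w i) ^ j * ch i (y \<oplus> s \<ominus> t))"
      unfolding P_def by (subst sum.swap[of _ I]) (intro sum.cong refl sum.swap)
    also have "\<dots> = (\<Sum>i\<in>I. c i * of_real (w i) ^ j * ch i y * (\<Sum>s\<in>X. \<Sum>t\<in>X. ch i (s \<ominus> t)))"
      unfolding sum_distrib_left
    proof (intro sum.cong refl)
      fix i s t assume "i \<in> I" "s \<in> X" "t \<in> X"
      moreover from this have "y \<oplus> s \<ominus> t = y \<oplus> (s \<ominus> t)"
        using y Xc by (simp add: a_minus_def a_assoc)
      ultimately show "c i * of_real (w i) ^ j * ch i (y \<oplus> s \<ominus> t)
          = c i * of_real (w i) ^ j * ch i y * ch i (s \<ominus> t)"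
        using y Xc ch by (simp add: character_add)
    qed
    also have "\<dots> = (\<Sum>i\<in>I. c i * of_real (w i) ^ j * ch i y * (of_real (cmod (\<Sum>s\<in>X. ch i s)))\<^sup>2)"
      using X by (intro sum.cong refl) (simp add: sum_characters_differences ch)
    also have "\<dots> / (of_nat (card X))\<^sup>2 = P (Suc j) y"
      unfolding P_def sum_divide_distrib
      by (intro sum.cong refl) (simp add: w_def power_divide mult_ac)
    finally show ?thesis by simp
  qed
  have P0: "P 0 y = H y" if "y \<in> carrier G" for y
    using that by (simp add: P_def H)
  have period: "cmod (P j (y \<oplus> s \<ominus> t) - P j y) \<le> \<eta>" if "y \<in> carrier G" "s \<in> X" "t \<in> X" for j y s t
    using that
  proof (induction j arbitrary: y s t)
    case 0
    then show ?case using \<eta> Xc by (simp add: P0)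
  next
    case (Suc j)
    \<comment> \<open>Averaging commutes with translations, so the almost periods of
      \<open>P j\<close> pass to \<open>P (Suc j)\<close> with the same \<eta>.\<close>
    have "P (Suc j) (y \<oplus> s \<ominus> t) - P (Suc j) y
      = (\<Sum>s'\<in>X. \<Sum>t'\<in>X. P j (y \<oplus> s' \<ominus> t' \<oplus> s \<ominus> t) - P j (y \<oplus> s' \<ominus> t')) / (of_nat (card X))\<^sup>2"
    proof -
      have "P j (y \<oplus> s \<ominus> t \<oplus> s' \<ominus> t') = P j (y \<oplus> s' \<ominus> t' \<oplus> s \<ominus> t)" if "s' \<in> X" "t' \<in> X" for s' t'
        using that Suc.prems Xc by (simp add: a_minus_def a_ac)
      then show ?thesis
        using Suc.prems Xc by (simp add: step sum_subtractf diff_divide_distrib)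
    qed
    also have "cmod \<dots> \<le> \<eta>"
      by (intro cmod_average2_le finX X(2) Suc.IH) (use Suc.prems Xc in simp_all)
    finally show ?case .
  qed
  have drift: "cmod (P j y - H y) \<le> real j * \<eta>" if y: "y \<in> carrier G" for j y
  proof (induction j)
    case 0
    then show ?case using y by (simp add: P0)
  next
    case (Suc j)
    have "P (Suc j) y - P j y
        = (\<Sum>s\<in>X. \<Sum>t\<in>X. P j (y \<oplus> s \<ominus> t) - P j y) / (of_nat (card X))\<^sup>2"
      using y cX by (simp add: step sum_subtractf diff_divide_distrib power2_eq_square)
    also have "cmod \<dots> \<le> \<eta>"
      using finX X(2) period y by (intro cmod_average2_le) auto
    finally have "cmod (P (Suc j) y - P j y) \<le> \<eta>" .
    with Suc show ?case
      using norm_triangle_ineq[of "P (Suc j) y - P j y" "P j y - H y"] by (simp add: algebra_simps)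
  qed
  \<comment> \<open>In the spectrum the difference vanishes because \<open>ch i t = 1\<close>;
    outside it the m-th power of the multiplier is at most 4^(-m).\<close>
  have tail: "cmod (c i * of_real (w i) ^ m * (ch i (x \<oplus> t) - ch i x)) \<le> cmod (c i) * (2 * (1 / 4) ^ m)"
    if i: "i \<in> I" for i
  proof (cases "cmod (\<Sum>x\<in>X. ch i x) \<ge> card X / 2")
    case True
    then have "ch i (x \<oplus> t) = ch i x" using t x ch i by (simp add: character_add)
    then show ?thesis by simp
  next
    case False
    then have "w i \<le> (1 / 2)\<^sup>2"
      unfolding w_def using cX by (intro power_mono) (auto simp: field_simps)
    then have "w i ^ m \<le> (1 / 4) ^ m"
      by (intro power_mono) (auto simp: w_def power2_eq_square)
    moreover have "cmod (ch i (x \<oplus> t) - ch i x) \<le> 2"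
      using norm_triangle_ineq4[of "ch i (x \<oplus> t)" "ch i x"] norm_character[OF ch[OF i]] x t by simp
    moreover have "0 \<le> w i" by (simp add: w_def)
    ultimately have "w i ^ m * cmod (ch i (x \<oplus> t) - ch i x) \<le> (1 / 4) ^ m * 2"
      by (intro mult_mono) auto
    then have "cmod (c i) * (w i ^ m * cmod (ch i (x \<oplus> t) - ch i x)) \<le> cmod (c i) * ((1 / 4) ^ m * 2)"
      by (rule mult_left_mono) simp
    then show ?thesis
      using \<open>0 \<le> w i\<close> by (simp add: norm_mult norm_power mult_ac)
  qed
  have "cmod (P m (x \<oplus> t) - P m x) = cmod (\<Sum>i\<in>I. c i * of_real (w i) ^ m * (ch i (x \<oplus> t) - ch i x))"
    by (simp add: P_def sum_subtractf right_diff_distrib)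
  also have "\<dots> \<le> (\<Sum>i\<in>I. cmod (c i) * (2 * (1 / 4) ^ m))"
    using tail by (rule sum_norm_le)
  also have "\<dots> = (\<Sum>i\<in>I. cmod (c i)) * (2 * (1 / 4) ^ m)"
    by (simp add: sum_distrib_right)
  also have "\<dots> \<le> B * (2 * (1 / 4) ^ m)"
    using B by (intro mult_right_mono) auto
  finally have "cmod (P m (x \<oplus> t) - P m x) \<le> 2 * B * (1 / 4) ^ m" by simp
  \<comment> \<open>Passing between \<open>H\<close> and \<open>P m\<close> costs m \<eta> at each
    of the points x and x + t; the remaining difference of \<open>P m\<close> is controlled by its
    Fourier coefficients.\<close>
  moreover have eq: "H (x \<oplus> t) - H x = (P m (x \<oplus> t) - P m x) - (P m (x \<oplus> t) - H (x \<oplus> t)) + (P m x - H x)"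
    by simp
  moreover have "cmod (P m (x \<oplus> t) - H (x \<oplus> t)) \<le> m * \<eta>" "cmod (P m x - H x) \<le> m * \<eta>"
    using drift x t by auto
  ultimately show ?thesis
    unfolding eq
    using norm_triangle_ineq[of "(P m (x \<oplus> t) - P m x) - (P m (x \<oplus> t) - H (x \<oplus> t))" "P m x - H x"]
      norm_triangle_ineq4[of "P m (x \<oplus> t) - P m x" "P m (x \<oplus> t) - H (x \<oplus> t)"] by linarith
qed

text \<open>The hypothesis \<open>orth\<close> expresses completeness of the family of characters,
  and takes the place of a description of the dual group. After the squares are expanded into
  differences s - t, only s = t survives.\<close>

lemma parseval_subset:
  assumes ch: "\<And>i. i \<in> I \<Longrightarrow> is_character (ch i)"
    and orth: "\<And>x. x \<in> carrier G \<Longrightarrow> (\<Sum>i\<in>I. ch i x) = (if x = \<zero> then of_nat (card (carrier G)) else 0)"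
    and A: "A \<subseteq> carrier G"
  shows "(\<Sum>i\<in>I. (cmod (\<Sum>a\<in>A. ch i a))\<^sup>2) = card (carrier G) * card A"
proof -
  have finA: "finite A" using A finite_carrier finite_subset by blast
  have Ac: "a \<in> carrier G" if "a \<in> A" for a using that A by blast
  have "complex_of_real (\<Sum>i\<in>I. (cmod (\<Sum>a\<in>A. ch i a))\<^sup>2) = (\<Sum>i\<in>I. \<Sum>s\<in>A. \<Sum>t\<in>A. ch i (s \<ominus> t))"
    using A ch by (simp add: sum_characters_differences)
  also have "\<dots> = (\<Sum>s\<in>A. \<Sum>t\<in>A. \<Sum>i\<in>I. ch i (s \<ominus> t))"
    by (subst sum.swap[of _ I]) (intro sum.cong refl sum.swap)
  also have "\<dots> = (\<Sum>s\<in>A. \<Sum>t\<in>A. if t = s then of_nat (card (carrier G)) else 0)"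
    using Ac by (intro sum.cong refl) (auto simp: orth minus_eq_zero_iff)
  also have "\<dots> = complex_of_real (real (card (carrier G) * card A))"
    using finA by simp
  finally show ?thesis by (simp only: of_real_eq_iff)
qed

lemma fourier_inversion_subset:
  assumes ch: "\<And>i. i \<in> I \<Longrightarrow> is_character (ch i)"
    and orth: "\<And>x. x \<in> carrier G \<Longrightarrow> (\<Sum>i\<in>I. ch i x) = (if x = \<zero> then of_nat (card (carrier G)) else 0)"
    and L: "L \<subseteq> carrier G" and x: "x \<in> carrier G"
  shows "ind L x = (\<Sum>i\<in>I. cnj (\<Sum>y\<in>L. ch i y) / of_nat (card (carrier G)) * ch i x)"
proof -
  have finL: "finite L" using L finite_carrier finite_subset by blast
  have "(\<Sum>i\<in>I. cnj (\<Sum>y\<in>L. ch i y) * ch i x) = (\<Sum>i\<in>I. \<Sum>y\<in>L. ch i (x \<ominus> y))"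
    unfolding cnj_sum sum_distrib_right using L x ch
    by (intro sum.cong refl) (auto simp: character_minus subset_iff)
  also have "\<dots> = (\<Sum>y\<in>L. \<Sum>i\<in>I. ch i (x \<ominus> y))" by (rule sum.swap)
  also have "\<dots> = (\<Sum>y\<in>L. if y = x then of_nat (card (carrier G)) else 0)"
    using L x by (intro sum.cong refl) (auto simp: orth minus_eq_zero_iff subset_iff)
  also have "\<dots> = of_nat (card (carrier G)) * ind L x"
    using finL by (simp add: indicator_def)
  finally show ?thesis
    using card_carrier_pos by (simp flip: sum_divide_distrib)
qed

text \<open>Each coefficient is a product of three normalised Fourier coefficients. That of
  \<open>L\<close> is at most 1 in modulus, those of \<open>A\<close> and \<open>M\<close> have
  square sums at most 1/\<alpha> by Parseval, and uv <= (u^2 + v^2)/2 plays the part of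
  Cauchy--Schwarz.\<close>

lemma average_fourier_expansion:
  fixes \<alpha> :: real
  assumes ch: "\<And>i. i \<in> I \<Longrightarrow> is_character (ch i)"
    and orth: "\<And>x. x \<in> carrier G \<Longrightarrow> (\<Sum>i\<in>I. ch i x) = (if x = \<zero> then of_nat (card (carrier G)) else 0)"
    and \<alpha>: "0 < \<alpha>"
    and A: "A \<subseteq> carrier G" "\<alpha> * card (carrier G) \<le> card A"
    and M: "M \<subseteq> carrier G" "\<alpha> * card (carrier G) \<le> card M"
    and L: "L \<subseteq> carrier G"
  obtains c where "(\<Sum>i\<in>I. cmod (c i)) \<le> 1 / \<alpha>"
    "\<And>x. x \<in> carrier G \<Longrightarrow>
      (\<Sum>m\<in>M. (\<Sum>a\<in>A. ind L (x \<ominus> m \<ominus> a)) / of_nat (card A)) / of_nat (card M) = (\<Sum>i\<in>I. c i * ch i x)"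
proof
  define c where "c i = cnj (\<Sum>y\<in>L. ch i y) / of_nat (card (carrier G))
    * (cnj (\<Sum>a\<in>A. ch i a) / of_nat (card A)) * (cnj (\<Sum>m\<in>M. ch i m) / of_nat (card M))" for i
  have pos: "real (card A) > 0" "real (card M) > 0"
    using card_pos_of_density[OF \<alpha>] A(2) M(2) by simp_all
  let ?N = "card (carrier G)"
  have sq: "(\<Sum>i\<in>I. (cmod (\<Sum>a\<in>S. ch i a) / card S)\<^sup>2) \<le> 1 / \<alpha>"
    if S: "S \<subseteq> carrier G" "\<alpha> * ?N \<le> card S" "real (card S) > 0" for S
  proof -
    have "(\<Sum>i\<in>I. (cmod (\<Sum>a\<in>S. ch i a) / card S)\<^sup>2) = ?N / card S"
      using S parseval_subset[OF ch orth S(1)]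
      by (simp add: power_divide flip: sum_divide_distrib) (simp add: power2_eq_square)
    also have "\<dots> \<le> 1 / \<alpha>" using S \<alpha> by (simp add: field_simps)
    finally show ?thesis .
  qed
  have "cmod (c i) \<le> ((cmod (\<Sum>a\<in>A. ch i a) / card A)\<^sup>2 + (cmod (\<Sum>m\<in>M. ch i m) / card M)\<^sup>2) / 2"
    if i: "i \<in> I" for i
  proof -
    let ?u = "cmod (\<Sum>a\<in>A. ch i a) / card A" and ?v = "cmod (\<Sum>m\<in>M. ch i m) / card M"
    have "cmod (\<Sum>y\<in>L. ch i y) \<le> (\<Sum>y\<in>L. 1)"
      using L norm_character[OF ch[OF i]] by (intro sum_norm_le) (auto simp: subset_iff)
    also have "\<dots> \<le> ?N" using card_mono[OF finite_carrier L] by simp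
    finally have "cmod (\<Sum>y\<in>L. ch i y) / ?N \<le> 1" using card_carrier_pos by simp
    then have "cmod (\<Sum>y\<in>L. ch i y) / ?N * (?u * ?v) \<le> 1 * (?u * ?v)"
      by (rule mult_right_mono) simp
    moreover have "cmod (c i) = cmod (\<Sum>y\<in>L. ch i y) / ?N * (?u * ?v)"
      by (simp only: c_def norm_mult norm_divide complex_mod_cnj norm_of_nat mult.assoc)
    ultimately have "cmod (c i) \<le> ?u * ?v" by (simp only: mult_1)
    moreover have "u * v \<le> (u\<^sup>2 + v\<^sup>2) / 2" for u v :: real
      using sum_squares_bound[of u v] by simp
    ultimately show ?thesis by (rule order_trans)
  qed
  then have "(\<Sum>i\<in>I. cmod (c i))
      \<le> (\<Sum>i\<in>I. ((cmod (\<Sum>a\<in>A. ch i a) / card A)\<^sup>2 + (cmod (\<Sum>m\<in>M. ch i m) / card M)\<^sup>2) / 2)"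
    by (rule sum_mono)
  also have "\<dots> = ((\<Sum>i\<in>I. (cmod (\<Sum>a\<in>A. ch i a) / card A)\<^sup>2)
      + (\<Sum>i\<in>I. (cmod (\<Sum>m\<in>M. ch i m) / card M)\<^sup>2)) / 2"
    by (simp only: sum.distrib flip: sum_divide_distrib)
  also have "\<dots> \<le> 1 / \<alpha>"
  proof -
    have "(u + v) / 2 \<le> r" if "u \<le> r" "v \<le> r" for u v r :: real using that by simp
    then show ?thesis using sq[OF A pos(1)] sq[OF M pos(2)] .
  qed
  finally show "(\<Sum>i\<in>I. cmod (c i)) \<le> 1 / \<alpha>" .
  fix x assume x: "x \<in> carrier G"
  define l where "l i = cnj (\<Sum>y\<in>L. ch i y) / of_nat ?N" for i
  have "(\<Sum>m\<in>M. \<Sum>a\<in>A. ind L (x \<ominus> m \<ominus> a)) = (\<Sum>m\<in>M. \<Sum>a\<in>A. \<Sum>i\<in>I. l i * ch i x * (cnj (ch i m) * cnj (ch i a)))"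
  proof (intro sum.cong refl)
    fix m a assume ma: "m \<in> M" "a \<in> A"
    then have c: "m \<in> carrier G" "a \<in> carrier G" using A M by auto
    then have "ind L (x \<ominus> m \<ominus> a) = (\<Sum>i\<in>I. l i * ch i (x \<ominus> m \<ominus> a))"
      using x unfolding l_def by (intro fourier_inversion_subset[OF ch orth L]) auto
    also have "\<dots> = (\<Sum>i\<in>I. l i * ch i x * (cnj (ch i m) * cnj (ch i a)))"
      using c x ch by (intro sum.cong refl) (simp add: character_minus)
    finally show "ind L (x \<ominus> m \<ominus> a) = (\<Sum>i\<in>I. l i * ch i x * (cnj (ch i m) * cnj (ch i a)))" .
  qed
  also have "\<dots> = (\<Sum>i\<in>I. \<Sum>m\<in>M. \<Sum>a\<in>A. l i * ch i x * (cnj (ch i m) * cnj (ch i a)))"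
    by (subst (2) sum.swap) (intro sum.cong refl sum.swap)
  also have "\<dots> = (\<Sum>i\<in>I. l i * ch i x * (cnj (\<Sum>m\<in>M. ch i m) * cnj (\<Sum>a\<in>A. ch i a)))"
    by (simp only: cnj_sum sum_product) (simp only: sum_distrib_left)
  finally have *: "(\<Sum>m\<in>M. \<Sum>a\<in>A. ind L (x \<ominus> m \<ominus> a))
      = (\<Sum>i\<in>I. l i * ch i x * (cnj (\<Sum>m\<in>M. ch i m) * cnj (\<Sum>a\<in>A. ch i a)))" .
  have "(\<Sum>m\<in>M. (\<Sum>a\<in>A. ind L (x \<ominus> m \<ominus> a)) / of_nat (card A)) / of_nat (card M)
      = (\<Sum>m\<in>M. \<Sum>a\<in>A. ind L (x \<ominus> m \<ominus> a)) / of_nat (card A) / of_nat (card M)"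
    by (simp add: sum_divide_distrib)
  also have "\<dots> = (\<Sum>i\<in>I. c i * ch i x)"
    unfolding * sum_divide_distrib by (intro sum.cong refl) (simp add: c_def l_def)
  finally show "(\<Sum>m\<in>M. (\<Sum>a\<in>A. ind L (x \<ominus> m \<ominus> a)) / of_nat (card A)) / of_nat (card M)
      = (\<Sum>i\<in>I. c i * ch i x)" .
qed

end

section \<open>Annihilators of the large spectrum\<close>

text \<open>A basis of \<open>W\<close> together with \<open>S\<close> spans the whole
  space.\<close>

lemma (in vectorspace) codim_le_card:
  assumes fin: "finite (carrier V)" and W: "subspace K W V"
    and S: "S \<subseteq> carrier V" and gen: "carrier V \<subseteq> span (W \<union> S)"
  shows "codim K V W \<le> card S"
proof -
  have sub: "submodule K W V" using W by simp
  then have WV: "W \<subseteq> carrier V" by (rule submodule.subset)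
  interpret W: vectorspace K "vs W" by (rule subspace_is_vs[OF W])
  have "W.span W \<subseteq> W" using W.span_is_subset2[of W] by simp
  then have "W.fin_dim"
    unfolding W.fin_dim_def using finite_subset[OF WV fin] W.in_own_span[of W]
    by (intro exI[of _ W]) auto
  then obtain B where B: "finite B" "W.basis B" using W.finite_basis_exists by blast
  have BW: "B \<subseteq> W" "W.span B = W" using B by (auto simp: W.basis_def)
  then have "span B = W" using span_li_not_depend(1)[OF BW(1) sub] by simp
  have finS: "finite S" using finite_subset[OF S fin] .
  have BS: "B \<union> S \<subseteq> carrier V" using BW WV S by blast
  have "W \<union> S \<subseteq> span (B \<union> S)"
    using span_is_monotone[of B "B \<union> S"] in_own_span[OF BS] \<open>span B = W\<close> by blast
  then have "span (W \<union> S) \<subseteq> span (B \<union> S)"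
    by (rule span_is_subset) (rule span_is_submodule[OF BS])
  then have "span (B \<union> S) = carrier V" using gen span_is_subset2[OF BS] by blast
  then have "dim \<le> card (B \<union> S)" using B finS BS by (intro gen_ge_dim) auto
  also have "\<dots> \<le> W.dim + card S"
    using card_Un_le[of B S] W.dim_basis[OF B] by simp
  finally show ?thesis by (simp add: codim_def)
qed

text \<open>
  Chang's theorem. Over a subspace \<open>W\<close> on which a character of the spectrum is nontrivial, the real
  part of this character has mean zero on every coset, so it can be added to the \<open>W\<close>-invariant
  function \<open>g\<close> at the cost of a bounded factor in the exponential moment.
\<close>

lemma (in vectorspace) spectrum_annihilator:
  fixes \<psi> :: "'a \<Rightarrow> complex" and \<Lambda> :: "('c \<Rightarrow> 'a) set"
  assumes fin: "finite (carrier V)" and \<psi>: "abelian_group.is_character K \<psi>"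
    and closed: "\<And>l x. l \<in> \<Lambda> \<Longrightarrow> x \<in> carrier V \<Longrightarrow> l x \<in> carrier K"
    and add: "\<And>l x y. l \<in> \<Lambda> \<Longrightarrow> x \<in> carrier V \<Longrightarrow> y \<in> carrier V \<Longrightarrow> l (x \<oplus>\<^bsub>V\<^esub> y) = l x \<oplus>\<^bsub>K\<^esub> l y"
    and smult: "\<And>l a x. l \<in> \<Lambda> \<Longrightarrow> a \<in> carrier K \<Longrightarrow> x \<in> carrier V \<Longrightarrow> l (a \<odot>\<^bsub>V\<^esub> x) = a \<otimes>\<^bsub>K\<^esub> l x"
    and X: "X \<subseteq> carrier V" "X \<noteq> {}"
    and big: "\<And>l. l \<in> \<Lambda> \<Longrightarrow> cmod (\<Sum>x\<in>X. \<psi> (l x)) \<ge> card X / 2"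
  obtains W where "subspace K W V" "codim K V W \<le> 16 * ln (card (carrier V) / card X)"
    "\<And>l w. l \<in> \<Lambda> \<Longrightarrow> w \<in> W \<Longrightarrow> \<psi> (l w) = 1"
proof -
  interpret fin: finite_abelian_group V by unfold_locales (rule fin)
  let ?N = "card (carrier V)"
  have Xfin: "finite X" using X fin finite_subset by blast
  then have cX: "0 < real (card X)" using X by (simp add: card_gt_0_iff)
  have N: "0 < real ?N" using fin.card_carrier_pos by simp
  have Xc: "x \<in> carrier V" if "x \<in> X" for x using X that by blast
  \<comment> \<open>State of an iteration after d steps. The set \<open>S\<close> witnesses that
    \<open>W\<close> has codimension at most d, and g stands for a sum of d rotated real parts of
    characters. Each step costs a factor at most exp (1/16) in the exponential moment and gains at
    least 1/2 in the mean over \<open>X\<close>.\<close>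
  define Q where "Q d W S g \<longleftrightarrow> subspace K W V \<and> S \<subseteq> carrier V \<and> card S \<le> d
      \<and> carrier V \<subseteq> span (W \<union> S)
      \<and> (\<forall>x\<in>carrier V. \<forall>w\<in>W. g (x \<oplus>\<^bsub>V\<^esub> w) = g x)
      \<and> (\<Sum>x\<in>carrier V. exp (g x / 4)) \<le> exp (real d / 16) * real ?N
      \<and> real (card X) * (real d / 2) \<le> (\<Sum>x\<in>X. g x)" for d W S and g :: "'c \<Rightarrow> real"
  \<comment> \<open>Jensen on \<open>X\<close> turns the mean d/2 of g into exp (d/8), which has to
    compete with exp (d/16) |V| / |X|.\<close>
  have bound: "real d \<le> 16 * ln (?N / card X)" if "Q d W S g" for d W S g
  proof -
    have "real (card X) * exp (real d / 8) \<le> card X * exp ((\<Sum>x\<in>X. g x / 4) / card X)"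
      using that cX by (simp add: Q_def field_simps flip: sum_divide_distrib)
    also have "\<dots> \<le> (\<Sum>x\<in>X. exp (g x / 4))"
      using Xfin X(2) by (rule jensen_exp)
    also have "\<dots> \<le> (\<Sum>x\<in>carrier V. exp (g x / 4))"
      using fin X by (intro sum_mono2) auto
    also have "\<dots> \<le> exp (real d / 16) * ?N" using that by (simp add: Q_def)
    finally have "exp (real d / 16) * (card X * exp (real d / 16)) \<le> exp (real d / 16) * ?N"
      by (simp add: mult_ac flip: exp_add)
    then have "card X * exp (real d / 16) \<le> ?N" by simp
    then have "exp (real d / 16) \<le> ?N / card X" using cX by (simp add: field_simps)
    then have "real d / 16 \<le> ln (?N / card X)"
      using cX N by (subst ln_ge_iff) auto
    then show ?thesis by simp
  qed
  have "subspace K (carrier V) V"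
    unfolding subspace_def by (intro conjI vectorspace_axioms submodule.intro module_axioms) auto
  moreover have "carrier V \<subseteq> span (carrier V \<union> {})" using in_own_span[of "carrier V"] by simp
  ultimately have "Q 0 (carrier V) {} (\<lambda>_. 0)" by (simp add: Q_def)
  then have ex: "\<exists>W S g. Q 0 W S g" by blast
  have le: "\<And>d. \<exists>W S g. Q d W S g \<Longrightarrow> d \<le> nat \<lfloor>16 * ln (?N / card X)\<rfloor>"
    using bound by (blast intro: le_nat_floor)
  \<comment> \<open>By \<open>bound\<close> the iteration stops. In a state with d maximal the whole
    spectrum is trivial on \<open>W\<close>, since otherwise one more step could be made.\<close>
  define d where "d = (GREATEST d. \<exists>W S g. Q d W S g)"
  have d: "\<exists>W S g. Q d W S g"
    unfolding d_def using ex le by (rule GreatestI_nat[where P = "\<lambda>d. \<exists>W S g. Q d W S g"])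
  have max: "d' \<le> d" if "\<exists>W S g. Q d' W S g" for d'
    unfolding d_def using that le by (rule Greatest_le_nat[where P = "\<lambda>d. \<exists>W S g. Q d W S g"])
  from d obtain W S g where Q: "Q d W S g" by blast
  have W: "subspace K W V" using Q by (simp add: Q_def)
  have sub: "submodule K W V" using W by simp
  have WV: "W \<subseteq> carrier V" using sub by (rule submodule.subset)
  have S: "S \<subseteq> carrier V" "finite S" "card S \<le> d" "carrier V \<subseteq> span (W \<union> S)"
    using Q fin finite_subset by (auto simp: Q_def)
  show thesis
  proof (rule that[OF W])
    have "codim K V W \<le> card S" using codim_le_card[OF fin W S(1,4)] .
    then show "codim K V W \<le> 16 * ln (?N / card X)" using S(3) bound[OF Q] by linarith
  next
    fix l w assume l: "l \<in> \<Lambda>" and w: "w \<in> W"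
    have wV: "w \<in> carrier V" using w WV by blast
    show "\<psi> (l w) = 1"
    proof (rule ccontr)
      assume nontrivial: "\<psi> (l w) \<noteq> 1"
      have psi0: "\<psi> \<zero>\<^bsub>K\<^esub> = 1" using \<psi> by (rule R.character_zero)
      then have lw: "l w \<in> carrier K" "l w \<noteq> \<zero>\<^bsub>K\<^esub>"
        using nontrivial closed[OF l wV] by auto
      define W' where "W' = {v \<in> W. l v = \<zero>\<^bsub>K\<^esub>}"
      define s where "s = (\<Sum>x\<in>X. \<psi> (l x))"
      \<comment> \<open>The phase rotates the character sum onto the positive axis, so
        \<open>r\<close> sums over \<open>X\<close> to |s| >= |X|/2.\<close>
      define r where "r x = Re (cnj s / cmod s * \<psi> (l x))" for x
      have s: "cmod s \<ge> card X / 2" using big[OF l] by (simp add: s_def)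
      then have s0: "cmod s > 0" using cX by linarith
      have r: "\<bar>r x\<bar> \<le> 1" if "x \<in> carrier V" for x
        using abs_Re_le_cmod[of "cnj s / cmod s * \<psi> (l x)"] s0 closed[OF l that] \<psi>
        by (simp add: r_def norm_mult norm_divide R.norm_character)
      have sumr: "(\<Sum>x\<in>X. r x) = cmod s"
      proof -
        have "(\<Sum>x\<in>X. r x) = Re (cnj s / cmod s * s)"
          by (simp only: r_def s_def Re_sum sum_distrib_left)
        also have "cnj s / cmod s * s = cmod s"
          using s0 complex_norm_square[of s] by (simp add: field_simps power2_eq_square)
        finally show ?thesis by simp
      qed
      have l0: "l \<zero>\<^bsub>V\<^esub> = \<zero>\<^bsub>K\<^esub>"
        using smult[OF l, of "\<zero>\<^bsub>K\<^esub>" w] closed[OF l wV] wV by simp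
      have W': "subspace K W' V"
      proof -
        have "submodule K W' V"
          using sub WV l0 add[OF l] smult[OF l] closed[OF l]
          by (intro submodule.intro module_axioms)
            (auto simp: W'_def submodule.m_closed submodule.smult_closed submodule.zero_closed subset_iff)
        then show ?thesis unfolding subspace_def using vectorspace_axioms by blast
      qed
      have S': "insert w S \<subseteq> carrier V" using S wV by blast
      have W'S': "W' \<union> insert w S \<subseteq> carrier V" using S' WV by (auto simp: W'_def)
      have spn: "submodule K (span (W' \<union> insert w S)) V" by (rule span_is_submodule[OF W'S'])
      have own: "W' \<union> insert w S \<subseteq> span (W' \<union> insert w S)" by (rule in_own_span[OF W'S'])
      \<comment> \<open>Modulo the kernel \<open>W'\<close> every x in \<open>W\<close> is a
        multiple of w: subtract k w with k = l x / l w. So the new state needs only one more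
        spanning vector.\<close>
      have "W \<subseteq> span (W' \<union> insert w S)"
      proof
        fix x assume x: "x \<in> W"
        then have xV: "x \<in> carrier V" using WV by blast
        define k where "k = l x \<otimes>\<^bsub>K\<^esub> inv\<^bsub>K\<^esub> (l w)"
        have iv: "inv\<^bsub>K\<^esub> (l w) \<in> carrier K" "inv\<^bsub>K\<^esub> (l w) \<otimes>\<^bsub>K\<^esub> l w = \<one>\<^bsub>K\<^esub>"
          using lw by (auto simp: field_Units)
        have k: "k \<in> carrier K" "k \<otimes>\<^bsub>K\<^esub> l w = l x"
          using closed[OF l xV] lw iv by (auto simp: k_def R.m_assoc)
        let ?y = "x \<oplus>\<^bsub>V\<^esub> (\<ominus>\<^bsub>K\<^esub> k) \<odot>\<^bsub>V\<^esub> w"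
        have "?y \<in> W" using sub x w k by (intro submodule.m_closed submodule.smult_closed) auto
        moreover have "l ?y = \<zero>\<^bsub>K\<^esub>"
          using add[OF l] smult[OF l] xV wV k closed[OF l xV] closed[OF l wV]
          by (simp add: R.l_minus R.r_neg)
        ultimately have y: "?y \<in> W'" by (simp add: W'_def)
        have "(\<ominus>\<^bsub>K\<^esub> k) \<odot>\<^bsub>V\<^esub> w \<oplus>\<^bsub>V\<^esub> k \<odot>\<^bsub>V\<^esub> w = \<zero>\<^bsub>V\<^esub>"
          using k wV by (simp add: R.l_neg flip: smult_l_distr)
        then have eq: "?y \<oplus>\<^bsub>V\<^esub> k \<odot>\<^bsub>V\<^esub> w = x"
          using xV wV k by (simp add: M.a_assoc)
        have "?y \<oplus>\<^bsub>V\<^esub> k \<odot>\<^bsub>V\<^esub> w \<in> span (W' \<union> insert w S)"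
        proof (rule submodule.m_closed[OF spn])
          show "?y \<in> span (W' \<union> insert w S)" using own y by blast
          have "w \<in> span (W' \<union> insert w S)" using own by blast
          then show "k \<odot>\<^bsub>V\<^esub> w \<in> span (W' \<union> insert w S)"
            by (rule submodule.smult_closed[OF spn k(1)])
        qed
        then show "x \<in> span (W' \<union> insert w S)" by (simp only: eq)
      qed
      moreover have "S \<subseteq> span (W' \<union> insert w S)" using own by blast
      ultimately have "span (W \<union> S) \<subseteq> span (W' \<union> insert w S)"
        by (intro span_is_subset[OF _ spn] Un_least)
      with S(4) have gen: "carrier V \<subseteq> span (W' \<union> insert w S)" by (rule order_trans)
      have inv: "g (x \<oplus>\<^bsub>V\<^esub> v) = g x" if "x \<in> carrier V" "v \<in> W" for x v
        using Q that by (simp add: Q_def)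
      \<comment> \<open>Translation by w fixes g and multiplies the sum by \<psi> (l w), which is
        not 1.\<close>
      have mean_zero: "(\<Sum>x\<in>carrier V. exp (g x / 4) * \<psi> (l x)) = 0"
      proof -
        let ?T = "\<Sum>x\<in>carrier V. exp (g x / 4) * \<psi> (l x)"
        have "?T = (\<Sum>x\<in>carrier V. exp (g (x \<oplus>\<^bsub>V\<^esub> w) / 4) * \<psi> (l (x \<oplus>\<^bsub>V\<^esub> w)))"
          using fin.sum_translate[OF wV, of "\<lambda>x. exp (g x / 4) * \<psi> (l x)"] by simp
        also have "\<dots> = (\<Sum>x\<in>carrier V. exp (g x / 4) * \<psi> (l x) * \<psi> (l w))"
          using inv[OF _ w] add[OF l _ wV] closed[OF l] wV \<psi>
          by (intro sum.cong refl) (simp add: R.character_add)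
        also have "\<dots> = ?T * \<psi> (l w)" by (simp add: sum_distrib_right)
        finally have "?T * (1 - \<psi> (l w)) = 0" by (simp add: algebra_simps)
        then show ?thesis using nontrivial by simp
      qed
      have sum_r: "(\<Sum>x\<in>carrier V. exp (g x / 4) * r x) = 0"
      proof -
        have "(\<Sum>x\<in>carrier V. exp (g x / 4) * r x)
            = Re (cnj s / cmod s * (\<Sum>x\<in>carrier V. exp (g x / 4) * \<psi> (l x)))"
          unfolding sum_distrib_left Re_sum
        proof (rule sum.cong[OF refl])
          fix x
          have "cnj s / cmod s * (exp (g x / 4) * \<psi> (l x)) = exp (g x / 4) * (cnj s / cmod s * \<psi> (l x))"
            by (simp add: mult_ac)
          then show "exp (g x / 4) * r x = Re (cnj s / cmod s * (exp (g x / 4) * \<psi> (l x)))"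
            by (simp only: r_def Re_complex_of_real Im_complex_of_real times_complex.sel mult_zero_left diff_zero)
        qed
        then show ?thesis using mean_zero by simp
      qed
      have "Q (Suc d) W' (insert w S) (\<lambda>x. g x + r x)"
        unfolding Q_def
      proof (intro conjI ballI)
        show "card (insert w S) \<le> Suc d" using S card_insert_le_m1[of "Suc d" S w] by simp
        show "g (x \<oplus>\<^bsub>V\<^esub> v) + r (x \<oplus>\<^bsub>V\<^esub> v) = g x + r x" if "x \<in> carrier V" "v \<in> W'" for x v
        proof -
          have "v \<in> W" "v \<in> carrier V" "l v = \<zero>\<^bsub>K\<^esub>" using that WV by (auto simp: W'_def)
          then show ?thesis using that inv add[OF l] closed[OF l] by (simp add: r_def)
        qed
        \<comment> \<open>Here 17/16 is 1 + (1/4)^2. The linear term of the quadratic bound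
          disappears by \<open>sum_r\<close>, and 17/16 <= exp (1/16).\<close>
        have "(\<Sum>x\<in>carrier V. exp ((g x + r x) / 4))
            \<le> (\<Sum>x\<in>carrier V. exp (g x / 4) * (17 / 16) + exp (g x / 4) * r x / 4)"
        proof (rule sum_mono)
          fix x assume "x \<in> carrier V"
          then have r1: "\<bar>r x\<bar> \<le> 1" by (rule r)
          then have "exp (r x / 4) \<le> 1 + r x / 4 + (r x / 4)\<^sup>2" by (intro exp_le_quadratic) simp
          moreover have "(r x)\<^sup>2 \<le> 1" using r1 by (simp add: abs_square_le_1)
          ultimately have "exp (r x / 4) \<le> 17 / 16 + r x / 4" by (simp add: power_divide)
          then have "exp (g x / 4) * exp (r x / 4) \<le> exp (g x / 4) * (17 / 16 + r x / 4)" by simp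
          then show "exp ((g x + r x) / 4) \<le> exp (g x / 4) * (17 / 16) + exp (g x / 4) * r x / 4"
            by (simp add: add_divide_distrib exp_add ring_distribs)
        qed
        also have "\<dots> = (\<Sum>x\<in>carrier V. exp (g x / 4)) * (17 / 16)"
          using sum_r by (simp add: sum.distrib flip: sum_divide_distrib sum_distrib_right)
        also have "\<dots> \<le> (exp (real d / 16) * ?N) * exp (1 / 16)"
          using Q exp_ge_add_one_self[of "1 / 16 :: real"]
          by (intro mult_mono) (auto simp: Q_def intro: sum_nonneg)
        also have "\<dots> = exp (real (Suc d) / 16) * ?N"
          by (simp add: add_divide_distrib exp_add)
        finally show "(\<Sum>x\<in>carrier V. exp ((g x + r x) / 4)) \<le> exp (real (Suc d) / 16) * ?N" .
        show "real (card X) * (real (Suc d) / 2) \<le> (\<Sum>x\<in>X. g x + r x)"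
          using Q s by (simp add: Q_def sum.distrib sumr ring_distribs add_divide_distrib)
      qed (fact W' S' gen)+
      then show False using max by (meson Suc_n_not_le_n)
    qed
  qed
qed

section \<open>Characters of coordinate spaces\<close>

text \<open>
  A maximal proper subgroup has cyclic quotient, so a character of the quotient is obtained by
  mapping a generator to a root of unity.
\<close>

lemma (in finite_abelian_group) exists_nontrivial_character:
  assumes "carrier G \<noteq> {\<zero>}"
  obtains \<chi> x where "is_character \<chi>" "x \<in> carrier G" "\<chi> x \<noteq> 1"
proof -
  define \<H> where "\<H> = {H. subgroup H (add_monoid G) \<and> H \<noteq> carrier G}"
  have "\<H> \<subseteq> Pow (carrier G)"
  proof
    fix H assume "H \<in> \<H>"
    then have "subgroup H (add_monoid G)" by (simp add: \<H>_def)
    from subgroup.subset[OF this] show "H \<in> Pow (carrier G)" by simp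
  qed
  then have "finite \<H>" using finite_carrier by (auto intro: finite_subset)
  moreover have "subgroup {\<zero>} (add_monoid G)"
    using add.triv_subgroup by simp
  then have "{\<zero>} \<in> \<H>" using assms by (auto simp: \<H>_def)
  ultimately obtain H where H: "H \<in> \<H>" and max: "\<And>H'. H' \<in> \<H> \<Longrightarrow> H \<subseteq> H' \<Longrightarrow> H' = H"
    using finite_has_maximal[of \<H>] by blast
  have sub: "subgroup H (add_monoid G)" using H by (simp add: \<H>_def)
  have HG: "h \<in> carrier G" if "h \<in> H" for h using subgroup.subset[OF sub] that by auto
  have H0: "\<zero> \<in> H" using subgroup.one_closed[OF sub] by simp
  have Hadd: "a \<oplus> b \<in> H" if "a \<in> H" "b \<in> H" for a b using subgroup.m_closed[OF sub that] by simp
  have Hinv: "\<ominus> a \<in> H" if "a \<in> H" for a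
    using subgroup.m_inv_closed[OF sub that] by (simp add: a_inv_def)
  obtain x where x: "x \<in> carrier G" "x \<notin> H"
    using H subgroup.subset[OF sub] by (auto simp: \<H>_def)
  define mul :: "int \<Rightarrow> 'a" where "mul k = [k] \<cdot> x" for k
  have mulG: "mul k \<in> carrier G" for k unfolding mul_def using x by simp
  have mul_add: "mul (j + k) = mul j \<oplus> mul k" for j k
    unfolding mul_def using x by (simp add: add.int_pow_mult)
  have mul_neg: "mul (- k) = \<ominus> mul k" for k
    unfolding mul_def using x by (simp add: add.int_pow_neg)
  have mul0: "mul 0 = \<zero>" by (simp add: mul_def add_pow_def)
  have mul1: "mul 1 = x" unfolding mul_def using x add.int_pow_1 by blast
  \<comment> \<open>The subgroup generated by \<open>H\<close> and x. By maximality of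
    \<open>H\<close> it is the whole group, so the class of x generates the quotient by
    \<open>H\<close>.\<close>
  define K where "K = {h \<oplus> mul k |h k. h \<in> H}"
  have "subgroup K (add_monoid G)"
  proof (rule add.subgroupI)
    show "K \<subseteq> carrier G" using HG mulG by (auto simp: K_def)
    show "K \<noteq> {}" using H0 by (auto simp: K_def)
    fix a assume "a \<in> K"
    then obtain h k where a: "a = h \<oplus> mul k" "h \<in> H" by (auto simp: K_def)
    then have "\<ominus> a = \<ominus> h \<oplus> mul (- k)" using HG mulG by (simp add: minus_add mul_neg)
    then show "\<ominus> a \<in> K" using Hinv[OF a(2)] by (auto simp: K_def)
    fix b assume "b \<in> K"
    then obtain h' k' where b: "b = h' \<oplus> mul k'" "h' \<in> H" by (auto simp: K_def)
    then have "a \<oplus> b = (h \<oplus> h') \<oplus> mul (k + k')" using a HG mulG by (simp add: mul_add a_ac)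
    then show "a \<oplus> b \<in> K" using Hadd a b by (auto simp: K_def)
  qed
  moreover have "H \<subseteq> K"
  proof
    fix h assume h: "h \<in> H"
    then have "h = h \<oplus> mul 0" using HG by (simp add: mul0)
    then show "h \<in> K" using h unfolding K_def by blast
  qed
  moreover have "x \<in> K"
  proof -
    have "x = \<zero> \<oplus> mul 1" using x by (simp add: mul1)
    then show ?thesis using H0 unfolding K_def by blast
  qed
  ultimately have K: "K = carrier G" using max[of K] x by (auto simp: \<H>_def)
  \<comment> \<open>The order of the class of x in the quotient by \<open>H\<close>.\<close>
  define n where "n = (LEAST n. 0 < n \<and> mul (int n) \<in> H)"
  have "0 < card (carrier G) \<and> mul (int (card (carrier G))) \<in> H"
  proof -
    have "x [^]\<^bsub>add_monoid G\<^esub> order (add_monoid G) = \<zero>"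
      using group.pow_order_eq_1[OF a_group, of x] x by simp
    then have "mul (int (card (carrier G))) = \<zero>"
      by (simp add: mul_def add_pow_def int_pow_int order_def)
    then show ?thesis using H0 card_carrier_pos by simp
  qed
  then have "0 < n \<and> mul (int n) \<in> H" unfolding n_def by (rule LeastI)
  then have n: "0 < n" "mul (int n) \<in> H" by auto
  have minimal: "n \<le> m" if "0 < m" "mul (int m) \<in> H" for m
    unfolding n_def using that by (intro Least_le) simp
  have n1: "n \<noteq> 1" using n x by (auto simp: mul1)
  \<comment> \<open>Division with remainder: the remainder of k modulo n again yields an element of
    \<open>H\<close>, and minimality of n forces it to be 0.\<close>
  have mulH: "int n dvd k" if k: "mul k \<in> H" for k
  proof -
    have "mul (int n * q) \<in> H" for q
    proof (induction q rule: int_induct[where k = 0])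
      case base then show ?case by (simp add: mul0 H0)
    next
      case (step1 i) then show ?case using Hadd n by (simp add: ring_distribs mul_add)
    next
      case (step2 i)
      have "mul (int n * (i - 1)) = mul (int n * i) \<oplus> mul (- int n)"
        by (simp add: right_diff_distrib flip: mul_add)
      then show ?case using step2 Hadd Hinv n by (simp add: mul_neg)
    qed
    from this[of "- (k div int n)"] have "mul (k + int n * - (k div int n)) \<in> H"
      using Hadd k by (simp only: mul_add)
    then have "mul (k mod int n) \<in> H" by (simp add: minus_mult_div_eq_mod flip: minus_mult_right)
    moreover have "0 \<le> k mod int n" "k mod int n < int n" using n by auto
    ultimately have "k mod int n = 0"
      using minimal[of "nat (k mod int n)"] by (cases "k mod int n = 0") (simp_all add: nat_less_iff)
    then show ?thesis by (simp add: dvd_eq_mod_eq_0)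
  qed
  define e where "e k = cis (2 * pi * (real_of_int k / n))" for k :: int
  have e_add: "e (j + k) = e j * e k" for j k
    by (simp add: e_def cis_mult ring_distribs add_divide_distrib)
  have e_dvd: "e k = 1" if dvd: "int n dvd k" for k
  proof -
    obtain q where "k = int n * q" using dvd by (rule dvdE)
    then have "real_of_int k / n = real_of_int q" using n by simp
    then show ?thesis by (simp add: e_def cis_multiple_2pi)
  qed
  \<comment> \<open>The representation y = h + k x determines k only modulo n, and \<open>e\<close>
    has period n, so the choice of k does not matter.\<close>
  define \<chi> where "\<chi> y = e (SOME k. \<exists>h\<in>H. y = h \<oplus> mul k)" for y
  have \<chi>: "\<chi> (h \<oplus> mul k) = e k" if h: "h \<in> H" for h k
  proof -
    define k' where "k' = (SOME k'. \<exists>h'\<in>H. h \<oplus> mul k = h' \<oplus> mul k')"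
    have "\<exists>h'\<in>H. h \<oplus> mul k = h' \<oplus> mul k'"
      unfolding k'_def by (rule someI[of "\<lambda>k'. \<exists>h'\<in>H. h \<oplus> mul k = h' \<oplus> mul k'" k]) (use h in blast)
    then obtain h' where h': "h' \<in> H" "h \<oplus> mul k = h' \<oplus> mul k'" by blast
    have "mul (k' + - k) = mul k' \<ominus> mul k" by (simp only: mul_add mul_neg a_minus_def)
    also have "mul k' = h \<oplus> mul k \<ominus> h'"
      using add_minus_cancel[of "mul k'" h'] HG[OF h'(1)] mulG by (simp add: h'(2) a_comm)
    also have "\<dots> = h \<ominus> h' \<oplus> mul k"
      using HG[OF h] HG[OF h'(1)] mulG by (simp add: a_minus_def a_ac)
    also have "\<dots> \<ominus> mul k = h \<oplus> \<ominus> h'"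
      using HG[OF h] HG[OF h'(1)] mulG by (simp add: add_minus_cancel) (simp add: a_minus_def)
    finally have "mul (k' + - k) \<in> H" using Hadd Hinv h h' by simp
    then have "e k' = e k" using e_add[of "k' + - k" k] e_dvd[OF mulH] by simp
    then show ?thesis by (simp add: \<chi>_def k'_def)
  qed
  show thesis
  proof (rule that)
    show "is_character \<chi>"
      unfolding is_character_def
    proof (intro conjI ballI)
      fix y z assume "y \<in> carrier G" "z \<in> carrier G"
      then obtain h k h' k' where y: "y = h \<oplus> mul k" "h \<in> H" and z: "z = h' \<oplus> mul k'" "h' \<in> H"
        unfolding K[symmetric] K_def by blast
      then have "y \<oplus> z = (h \<oplus> h') \<oplus> mul (k + k')" using HG mulG by (simp add: mul_add a_ac)
      then show "\<chi> (y \<oplus> z) = \<chi> y * \<chi> z" using y z Hadd by (simp add: \<chi> e_add)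
    next
      fix y show "cmod (\<chi> y) = 1" by (simp add: \<chi>_def e_def)
    qed
    have "\<chi> x = e 1" using \<chi>[OF H0, of 1] x by (simp add: mul1)
    moreover have "e 1 \<noteq> 1"
    proof
      assume "e 1 = 1"
      then have "cos (2 * pi * (1 / n)) = 1" by (simp add: e_def complex_eq_iff)
      then obtain j :: int where "2 * pi * (1 / n) = j * 2 * pi" using cos_one_2pi_int by auto
      then have "real_of_int j * real n = 1" using n by (simp add: field_simps)
      then have "j * int n = 1" by (metis of_int_1 of_int_eq_iff of_int_mult of_int_of_nat_eq)
      then have "int n dvd 1" by (metis dvd_triv_right)
      then show False using n1 by simp
    qed
    ultimately show "\<chi> x \<noteq> 1" by simp
  qed (fact x(1))
qed

section \<open>The standard bilinear form and orthogonality of the characters it induces\<close>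

definition (in ring) dot :: "nat \<Rightarrow> (nat \<Rightarrow> 'a) \<Rightarrow> (nat \<Rightarrow> 'a) \<Rightarrow> 'a"
  where "dot n l x = (\<Oplus>i\<in>{..<n}. l i \<otimes> x i)"

context cring
begin

lemma coord_space_simps:
  "carrier (coord_space R n) = {..<n} \<rightarrow>\<^sub>E carrier R"
  "x \<oplus>\<^bsub>coord_space R n\<^esub> y = (\<lambda>i\<in>{..<n}. x i \<oplus> y i)"
  "c \<odot>\<^bsub>coord_space R n\<^esub> x = (\<lambda>i\<in>{..<n}. c \<otimes> x i)"
  "\<zero>\<^bsub>coord_space R n\<^esub> = (\<lambda>i\<in>{..<n}. \<zero>)"
  by (simp_all add: func_space_def)

lemma coord_mem: "x \<in> carrier (coord_space R n) \<Longrightarrow> i < n \<Longrightarrow> x i \<in> carrier R"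
  unfolding coord_space_simps by (auto dest: PiE_mem)

lemma dot_closed:
  "l \<in> carrier (coord_space R n) \<Longrightarrow> x \<in> carrier (coord_space R n) \<Longrightarrow> dot n l x \<in> carrier R"
  unfolding dot_def by (intro finsum_closed) (auto simp: coord_mem)

lemma dot_add_right:
  assumes "l \<in> carrier (coord_space R n)" "x \<in> carrier (coord_space R n)" "y \<in> carrier (coord_space R n)"
  shows "dot n l (x \<oplus>\<^bsub>coord_space R n\<^esub> y) = dot n l x \<oplus> dot n l y"
proof -
  have "dot n l (x \<oplus>\<^bsub>coord_space R n\<^esub> y) = (\<Oplus>i\<in>{..<n}. l i \<otimes> x i \<oplus> l i \<otimes> y i)"
    unfolding dot_def coord_space_simps using assms
    by (intro finsum_cong') (auto simp: coord_mem r_distr)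
  also have "\<dots> = dot n l x \<oplus> dot n l y"
    unfolding dot_def using assms by (intro finsum_addf) (auto simp: coord_mem)
  finally show ?thesis .
qed

lemma dot_commute:
  assumes "l \<in> carrier (coord_space R n)" "x \<in> carrier (coord_space R n)"
  shows "dot n l x = dot n x l"
  unfolding dot_def using assms by (intro finsum_cong') (auto simp: coord_mem m_comm)

lemma dot_smult_right:
  assumes "l \<in> carrier (coord_space R n)" "x \<in> carrier (coord_space R n)" "c \<in> carrier R"
  shows "dot n l (c \<odot>\<^bsub>coord_space R n\<^esub> x) = c \<otimes> dot n l x"
proof -
  have "dot n l (c \<odot>\<^bsub>coord_space R n\<^esub> x) = (\<Oplus>i\<in>{..<n}. c \<otimes> (l i \<otimes> x i))"
    unfolding dot_def coord_space_simps using assms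
    by (intro finsum_cong') (auto simp: coord_mem m_lcomm)
  also have "\<dots> = c \<otimes> dot n l x"
    unfolding dot_def using assms by (intro finsum_rdistr[symmetric]) (auto simp: coord_mem)
  finally show ?thesis .
qed

end

text \<open>A vector l supported on a single coordinate at which x is nonzero suffices.\<close>

lemma (in field) exists_dot_eq:
  assumes x: "x \<in> carrier (coord_space R n)" "x \<noteq> \<zero>\<^bsub>coord_space R n\<^esub>" and c: "c \<in> carrier R"
  obtains l where "l \<in> carrier (coord_space R n)" "dot n l x = c"
proof -
  have "\<exists>j<n. x j \<noteq> \<zero>"
  proof (rule ccontr)
    assume *: "\<not> (\<exists>j<n. x j \<noteq> \<zero>)"
    have "x i = (\<lambda>i\<in>{..<n}. \<zero>) i" for i
      using * x(1) unfolding coord_space_simps by (cases "i < n") (auto dest: PiE_arb)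
    then show False using x(2) unfolding coord_space_simps by blast
  qed
  then obtain j where j: "j < n" "x j \<noteq> \<zero>" by blast
  have xj: "x j \<in> carrier R" "inv (x j) \<in> carrier R" "inv (x j) \<otimes> x j = \<one>"
    using coord_mem[OF x(1) j(1)] j(2) by (auto simp: field_Units)
  define l where "l = (\<lambda>i\<in>{..<n}. if i = j then c \<otimes> inv (x j) else \<zero>)"
  have l: "l \<in> carrier (coord_space R n)"
    using c xj unfolding coord_space_simps l_def by (intro restrict_PiE_iff[THEN iffD2]) auto
  have "dot n l x = (\<Oplus>i\<in>{..<n}. if j = i then c else \<zero>)"
    unfolding dot_def using c xj x(1)
    by (intro finsum_cong') (auto simp: l_def coord_mem m_assoc)
  also have "\<dots> = c"
    using finsum_singleton[of j "{..<n}" "\<lambda>_. c"] j(1) c by simp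
  finally show thesis using that l by blast
qed

text \<open>Derives completeness of the characters indexed by the vectors l from one nontrivial
  character of the field. For nonzero x some e has product c with x, and translating l by e
  multiplies the sum by \<psi> c, so the sum vanishes.\<close>

lemma (in field) sum_characters_coord_space:
  assumes fin: "finite (carrier R)" and \<psi>: "is_character \<psi>" "c \<in> carrier R" "\<psi> c \<noteq> 1"
    and x: "x \<in> carrier (coord_space R n)"
  shows "(\<Sum>l\<in>carrier (coord_space R n). \<psi> (dot n l x))
    = (if x = \<zero>\<^bsub>coord_space R n\<^esub> then of_nat (card (carrier (coord_space R n))) else 0)"
proof -
  interpret M: module R "coord_space R n" by (rule func_space_is_module)
  interpret V: finite_abelian_group "coord_space R n"
    by unfold_locales (use fin in \<open>auto simp: coord_space_simps finite_PiE\<close>)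
  show ?thesis
  proof (cases "x = \<zero>\<^bsub>coord_space R n\<^esub>")
    case True
    have "dot n l x = \<zero>" if "l \<in> carrier (coord_space R n)" for l
      using dot_smult_right[OF that x zero_closed] dot_closed[OF that x] x
      by (simp add: True)
    then show ?thesis using True character_zero[OF \<psi>(1)] by simp
  next
    case False
    then obtain e where e: "e \<in> carrier (coord_space R n)" "dot n e x = c"
      using exists_dot_eq[OF x _ \<psi>(2)] by blast
    let ?T = "\<Sum>l\<in>carrier (coord_space R n). \<psi> (dot n l x)"
    have "?T = (\<Sum>l\<in>carrier (coord_space R n). \<psi> (dot n (l \<oplus>\<^bsub>coord_space R n\<^esub> e) x))"
      using V.sum_translate[OF e(1), of "\<lambda>l. \<psi> (dot n l x)"] by simp
    also have "\<dots> = (\<Sum>l\<in>carrier (coord_space R n). \<psi> (dot n l x) * \<psi> c)"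
    proof (intro sum.cong refl)
      fix l assume l: "l \<in> carrier (coord_space R n)"
      have "dot n (l \<oplus>\<^bsub>coord_space R n\<^esub> e) x = dot n l x \<oplus> c"
        using dot_add_right[OF x l e(1)] dot_commute[OF x] l e by simp
      then show "\<psi> (dot n (l \<oplus>\<^bsub>coord_space R n\<^esub> e) x) = \<psi> (dot n l x) * \<psi> c"
        using character_add[OF \<psi>(1) dot_closed[OF l x] \<psi>(2)] by simp
    qed
    also have "\<dots> = ?T * \<psi> c" by (simp add: sum_distrib_right)
    finally have "?T * (1 - \<psi> c) = 0" by (simp add: algebra_simps)
    then show ?thesis using False \<psi>(3) by simp
  qed
qed

section \<open>Almost periodicity\<close>

lemma sum_ind_mult:
  assumes "finite B" "A \<subseteq> B"
  shows "(\<Sum>y\<in>B. ind A y * f y) = (\<Sum>y\<in>A. f y)"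
  using assms by (intro sum.mono_neutral_cong_right) (auto simp: indicator_def)

context finite_abelian_group
begin

lemma convolution_indicators:
  assumes A: "A \<subseteq> carrier G" and M: "M \<subseteq> carrier G" and x: "x \<in> carrier G"
  shows "convolution G (convolution G (ind A) (ind M)) (ind L) x
    = (\<Sum>m\<in>M. \<Sum>a\<in>A. ind L (x \<ominus> m \<ominus> a))"
proof -
  have "convolution G (convolution G (ind A) (ind M)) (ind L) x
      = (\<Sum>z\<in>carrier G. \<Sum>a\<in>A. ind M (z \<ominus> a) * ind L (x \<ominus> z))"
    unfolding convolution_def using sum_ind_mult[OF finite_carrier A]
    by (simp add: sum_distrib_right)
  also have "\<dots> = (\<Sum>a\<in>A. \<Sum>z\<in>carrier G. ind M (z \<ominus> a) * ind L (x \<ominus> z))"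
    by (rule sum.swap)
  also have "\<dots> = (\<Sum>a\<in>A. \<Sum>m\<in>M. ind L (x \<ominus> m \<ominus> a))"
  proof (rule sum.cong[OF refl])
    fix a assume "a \<in> A"
    then have a: "a \<in> carrier G" using A by blast
    have "(\<Sum>z\<in>carrier G. ind M (z \<ominus> a) * ind L (x \<ominus> z))
        = (\<Sum>z\<in>carrier G. ind M (z \<oplus> a \<ominus> a) * ind L (x \<ominus> (z \<oplus> a)))"
      using sum_translate[OF a, of "\<lambda>z. ind M (z \<ominus> a) * ind L (x \<ominus> z)"] by simp
    also have "\<dots> = (\<Sum>z\<in>carrier G. ind M z * ind L (x \<ominus> z \<ominus> a))"
      using a x by (intro sum.cong refl) (simp add: add_minus_cancel, simp add: a_minus_def minus_add a_assoc)
    also have "\<dots> = (\<Sum>m\<in>M. ind L (x \<ominus> m \<ominus> a))"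
      by (rule sum_ind_mult[OF finite_carrier M])
    finally show "(\<Sum>z\<in>carrier G. ind M (z \<ominus> a) * ind L (x \<ominus> z)) = (\<Sum>m\<in>M. ind L (x \<ominus> m \<ominus> a))" .
  qed
  also have "\<dots> = (\<Sum>m\<in>M. \<Sum>a\<in>A. ind L (x \<ominus> m \<ominus> a))" by (rule sum.swap)
  finally show ?thesis .
qed

text \<open>Convolution at zero evaluates the weight at -y. By the symmetry of \<open>S\<close> it
  is therefore the plain average of \<open>T\<close> over \<open>S\<close>.\<close>

lemma uniform_average_near:
  assumes S: "S \<subseteq> carrier G" "S \<noteq> {}" "\<And>y. y \<in> S \<Longrightarrow> \<ominus> y \<in> S"
    and b: "\<And>t. t \<in> S \<Longrightarrow> cmod (T t - T \<zero>) \<le> b"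
  shows "cmod (T \<zero> - convolution G T (uniform_weight S) \<zero>) \<le> b"
proof -
  have "finite S" using S finite_carrier finite_subset by blast
  then have cS: "card S > 0" using S by (simp add: card_gt_0_iff)
  have "convolution G T (uniform_weight S) \<zero> = (\<Sum>y\<in>carrier G. ind S y * (T y / of_nat (card S)))"
    unfolding convolution_def
  proof (rule sum.cong[OF refl])
    fix y assume y: "y \<in> carrier G"
    have "\<ominus> y \<in> S \<longleftrightarrow> y \<in> S" using S(3)[of y] S(3)[of "\<ominus> y"] y by auto
    then show "T y * uniform_weight S (\<zero> \<ominus> y) = ind S y * (T y / of_nat (card S))"
      using y by (simp add: uniform_weight_def a_minus_def indicator_def)
  qed
  also have "\<dots> = (\<Sum>y\<in>S. T y / of_nat (card S))"
    by (rule sum_ind_mult[OF finite_carrier S(1)])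
  finally have "T \<zero> - convolution G T (uniform_weight S) \<zero> = - (\<Sum>y\<in>S. (T y - T \<zero>) / of_nat (card S))"
    using cS by (simp add: diff_divide_distrib sum_subtractf)
  also have "cmod \<dots> \<le> (\<Sum>y\<in>S. b / card S)"
    unfolding norm_minus_cancel using b
    by (intro sum_norm_le) (simp add: norm_divide divide_right_mono)
  also have "\<dots> = b" using cS by simp
  finally show ?thesis .
qed

end

section \<open>Choice of the sampling and smoothing parameters\<close>

lemma almost_periodicity_parameters:
  fixes \<epsilon> \<alpha> :: real
  assumes \<epsilon>: "0 < \<epsilon>" "\<epsilon> < 1" and \<alpha>: "0 < \<alpha>" "\<alpha> \<le> 1"
  obtains m k :: nat and \<delta> :: real where "0 < \<delta>" "\<delta> \<le> 1" "0 < k" "8 * ln (2 / \<alpha>) / \<delta>\<^sup>2 \<le> k"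
    "2 * real m * (2 * \<delta>) + 2 * (1 / \<alpha>) * (1 / 4) ^ m \<le> \<epsilon>"
    "16 * (k * ln (2 / \<alpha>)) \<le> 262144 * (1 / \<epsilon>\<^sup>2) * (ln (2 / (\<epsilon> * \<alpha>)))\<^sup>2 * (ln (2 / \<alpha>))\<^sup>2"
proof -
  define l where "l = ln (2 / \<alpha>)"
  define \<Lambda> where "\<Lambda> = ln (2 / (\<epsilon> * \<alpha>))"
  \<comment> \<open>Keeps both logarithms at least 1/2, so that rounding up costs at most a factor 2
    in \<open>m\<close> and in \<open>k\<close>.\<close>
  have ln2: "1 / 2 \<le> ln (2 :: real)"
  proof -
    have "exp (1 / 2 :: real) \<le> 2" using exp_bound[of "1 / 2"] by (simp add: power2_eq_square)
    then show ?thesis by (subst ln_ge_iff) auto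
  qed
  have "ln 2 \<le> l" unfolding l_def using \<alpha> by (subst ln_le_cancel_iff) (auto simp: field_simps)
  then have l: "1 / 2 \<le> l" using ln2 by linarith
  have ea: "0 < \<epsilon> * \<alpha>" "\<epsilon> * \<alpha> \<le> 1" using \<epsilon> \<alpha> by (auto simp: mult_le_one)
  have "ln 2 \<le> \<Lambda>" unfolding \<Lambda>_def using ea by (subst ln_le_cancel_iff) (auto simp: field_simps)
  then have \<Lambda>: "1 / 2 \<le> \<Lambda>" using ln2 by linarith
  \<comment> \<open>Ensures 4^m >= exp (2 \<Lambda>) = (2/(\<epsilon>\<alpha>))^2 >=
    4/(\<epsilon>\<alpha>), which bounds the Fourier tail by \<epsilon>/2.\<close>
  define m where "m = nat \<lceil>2 * \<Lambda>\<rceil>"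
  have m: "2 * \<Lambda> \<le> m" "m \<le> 4 * \<Lambda>" "1 \<le> real m"
    using \<Lambda> unfolding m_def by linarith+
  \<comment> \<open>Makes the total drift of m averagings at two points, each with error 2\<delta>,
    exactly \<epsilon>/2.\<close>
  define \<delta> where "\<delta> = \<epsilon> / (8 * m)"
  have \<delta>: "0 < \<delta>" "\<delta> \<le> 1" using \<epsilon> m by (auto simp: \<delta>_def field_simps)
  define k where "k = nat \<lceil>8 * l / \<delta>\<^sup>2\<rceil>"
  have "\<delta>\<^sup>2 \<le> 1" using \<delta> by (simp add: power_le_one)
  then have "1 \<le> 8 * l / \<delta>\<^sup>2" using l \<delta> by (simp add: field_simps)
  then have k: "0 < k" "8 * l / \<delta>\<^sup>2 \<le> k" "k \<le> 2 * (8 * l / \<delta>\<^sup>2)"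
    unfolding k_def by linarith+
  show thesis
  proof (rule that[of \<delta> k m])
    show "8 * ln (2 / \<alpha>) / \<delta>\<^sup>2 \<le> k" using k(2) by (simp add: l_def)
    have "2 * real m * (2 * \<delta>) = \<epsilon> / 2" using m by (simp add: \<delta>_def)
    moreover have "4 / (\<epsilon> * \<alpha>) \<le> 4 ^ m"
    proof -
      have "4 / (\<epsilon> * \<alpha>) \<le> (2 / (\<epsilon> * \<alpha>))\<^sup>2"
        using ea \<epsilon> \<alpha> by (simp add: power2_eq_square field_simps)
      also have "2 / (\<epsilon> * \<alpha>) = exp \<Lambda>"
        unfolding \<Lambda>_def using ea(1) by (intro exp_ln[symmetric] divide_pos_pos) simp
      also have "(exp \<Lambda>)\<^sup>2 = exp (2 * \<Lambda>)" by (simp add: exp_double)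
      also have "\<dots> \<le> exp (real m)" using m by simp
      also have "\<dots> = exp 1 ^ m" by (simp flip: exp_of_nat_mult)
      also have "\<dots> \<le> 4 ^ m" using exp_le by (intro power_mono) auto
      finally show ?thesis .
    qed
    then have "(1 / 4) ^ m \<le> \<epsilon> * \<alpha> / 4"
      using ea(1) by (simp add: power_one_over divide_simps mult_ac)
    then have "2 * (1 / \<alpha>) * (1 / 4) ^ m \<le> 2 * (1 / \<alpha>) * (\<epsilon> * \<alpha> / 4)"
      using \<alpha> by (intro mult_left_mono) auto
    then have "2 * (1 / \<alpha>) * (1 / 4) ^ m \<le> \<epsilon> / 2"
      using \<alpha> by simp
    ultimately show "2 * real m * (2 * \<delta>) + 2 * (1 / \<alpha>) * (1 / 4) ^ m \<le> \<epsilon>" by linarith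
    \<comment> \<open>The constant is 16 * 2 * 8 * 64 = 16384, where 64 comes from 1/\<delta>^2,
      times the 16 from m <= 4\<Lambda>.\<close>
    have "16 * (k * l) \<le> 16 * (2 * (8 * l / \<delta>\<^sup>2) * l)"
      using k l by (intro mult_left_mono mult_right_mono) auto
    also have "\<dots> = 16384 * (1 / \<epsilon>\<^sup>2) * (real m)\<^sup>2 * l\<^sup>2"
      by (simp add: \<delta>_def power2_eq_square)
    also have "\<dots> \<le> 16384 * (1 / \<epsilon>\<^sup>2) * (4 * \<Lambda>)\<^sup>2 * l\<^sup>2"
      using m by (intro mult_left_mono mult_right_mono power_mono) auto
    also have "\<dots> = 262144 * (1 / \<epsilon>\<^sup>2) * \<Lambda>\<^sup>2 * l\<^sup>2" by (simp add: power_mult_distrib)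
    finally show "16 * (k * ln (2 / \<alpha>)) \<le> 262144 * (1 / \<epsilon>\<^sup>2) * (ln (2 / (\<epsilon> * \<alpha>)))\<^sup>2 * (ln (2 / \<alpha>))\<^sup>2"
      by (simp add: l_def \<Lambda>_def)
  qed (use \<delta> k in auto)
qed

text \<open>Assembles the pieces for \<open>H\<close>, which is \<open>T A M L\<close> divided by
  |A| |M|. Sampling supplies a set \<open>X\<close> of shifts, and the subspace is one on which the
  1/2-spectrum of \<open>X\<close> is trivial.\<close>

lemma (in field) almost_periodicity_coord_space:
  fixes \<epsilon> \<alpha> :: real and n :: nat
  defines "G \<equiv> coord_space R n"
  defines "T \<equiv> \<lambda>A M L. convolution G (convolution G (ind A) (ind M)) (ind L)"
  assumes fin: "finite (carrier R)" and \<epsilon>: "0 < \<epsilon>" "\<epsilon> < 1" and \<alpha>: "0 < \<alpha>" "\<alpha> \<le> 1"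
    and A: "A \<subseteq> carrier G" "\<alpha> * card (carrier G) \<le> card A"
    and M: "M \<subseteq> carrier G" "\<alpha> * card (carrier G) \<le> card M"
    and L: "L \<subseteq> carrier G"
  obtains V where "subspace R V G"
    "codim R G V \<le> 262144 * (1 / \<epsilon>\<^sup>2) * (ln (2 / (\<epsilon> * \<alpha>)))\<^sup>2 * (ln (2 / \<alpha>))\<^sup>2"
    "\<And>x t. x \<in> carrier G \<Longrightarrow> t \<in> V \<Longrightarrow>
      cmod (T A M L (x \<oplus>\<^bsub>G\<^esub> t) - T A M L x) \<le> \<epsilon> * card A * card M"
proof -
  interpret V: vectorspace R G
    unfolding vectorspace_def G_def using func_space_is_module field_axioms by blast
  interpret V: finite_abelian_group G
    by unfold_locales (use fin in \<open>auto simp: G_def coord_space_simps finite_PiE\<close>)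
  interpret K: finite_abelian_group R by unfold_locales (rule fin)
  let ?N = "card (carrier G)"
  have "\<one> \<in> carrier R" "\<one> \<noteq> \<zero>" by simp_all
  then have "carrier R \<noteq> {\<zero>}" by blast
  then obtain \<psi> c where \<psi>: "is_character \<psi>" "c \<in> carrier R" "\<psi> c \<noteq> 1"
    using K.exists_nontrivial_character by blast
  define ch where "ch l x = \<psi> (dot n l x)" for l x
  have ch: "V.is_character (ch l)" if "l \<in> carrier G" for l
    unfolding V.is_character_def ch_def using that
    by (auto simp: G_def dot_add_right character_add[OF \<psi>(1)] norm_character[OF \<psi>(1)] dot_closed)
  have orth: "(\<Sum>l\<in>carrier G. ch l x) = (if x = \<zero>\<^bsub>G\<^esub> then of_nat ?N else 0)" if "x \<in> carrier G" for x
    unfolding ch_def using sum_characters_coord_space[OF fin \<psi>] that by (simp add: G_def)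
  have pos: "0 < real (card A)" "0 < real (card M)"
    using V.card_pos_of_density[OF \<alpha>(1) A(2)] V.card_pos_of_density[OF \<alpha>(1) M(2)] by simp_all
  obtain m k :: nat and \<delta> where \<delta>: "0 < \<delta>" "\<delta> \<le> 1" and k: "0 < k" "8 * ln (2 / \<alpha>) / \<delta>\<^sup>2 \<le> k"
    and m: "2 * real m * (2 * \<delta>) + 2 * (1 / \<alpha>) * (1 / 4) ^ m \<le> \<epsilon>"
    and final: "16 * (k * ln (2 / \<alpha>))
      \<le> 262144 * (1 / \<epsilon>\<^sup>2) * (ln (2 / (\<epsilon> * \<alpha>)))\<^sup>2 * (ln (2 / \<alpha>))\<^sup>2"
    using almost_periodicity_parameters[OF \<epsilon> \<alpha>] by blast
  \<comment> \<open>The same average appears twice: real-valued for the sampling, complex-valued for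
    the Fourier expansion.\<close>
  define Hr :: "(nat \<Rightarrow> 'a) \<Rightarrow> real" where
    "Hr x = (\<Sum>m\<in>M. (\<Sum>a\<in>A. indicator L (x \<ominus>\<^bsub>G\<^esub> m \<ominus>\<^bsub>G\<^esub> a)) / card A) / card M" for x
  define H :: "(nat \<Rightarrow> 'a) \<Rightarrow> complex" where
    "H x = (\<Sum>m\<in>M. (\<Sum>a\<in>A. ind L (x \<ominus>\<^bsub>G\<^esub> m \<ominus>\<^bsub>G\<^esub> a)) / of_nat (card A)) / of_nat (card M)" for x
  have H_of_real: "H x = of_real (Hr x)" for x
  proof -
    have "ind L y = of_real (indicator L y)" for y by (simp add: indicator_def)
    then show ?thesis by (simp add: H_def Hr_def)
  qed
  have T: "T A M L x = of_real (card A * card M) * H x" if "x \<in> carrier G" for x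
    using V.convolution_indicators[OF A(1) M(1) that, of L] pos
    by (simp add: T_def H_def flip: sum_divide_distrib)
  obtain X where X: "X \<subseteq> carrier G" "\<alpha> ^ k * ?N \<le> 2 * card X" and
    period: "\<And>x s t. x \<in> carrier G \<Longrightarrow> s \<in> X \<Longrightarrow> t \<in> X \<Longrightarrow> \<bar>Hr (x \<oplus>\<^bsub>G\<^esub> s \<ominus>\<^bsub>G\<^esub> t) - Hr x\<bar> \<le> 2 * \<delta>"
    using V.croot_sisask[where f = "indicator L" and \<alpha> = \<alpha> and A = A and M = M and \<delta> = \<delta> and k = k] A M \<alpha> \<delta> k unfolding Hr_def
    by (auto simp: indicator_def)
  have "0 < \<alpha> ^ k * ?N" using \<alpha> V.card_carrier_pos by simp
  then have cX: "0 < real (card X)" using X(2) by linarith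
  then have "X \<noteq> {}" by auto
  \<comment> \<open>The spectrum is recorded as a set of linear functionals with values in the
    field, so that kernels are subspaces and not merely subgroups.\<close>
  define \<Lambda> where "\<Lambda> = dot n ` {l \<in> carrier G. cmod (\<Sum>x\<in>X. ch l x) \<ge> card X / 2}"
  obtain W where W: "subspace R W G" "codim R G W \<le> 16 * ln (?N / card X)"
    and ann: "\<And>l w. l \<in> \<Lambda> \<Longrightarrow> w \<in> W \<Longrightarrow> \<psi> (l w) = 1"
  proof (rule V.spectrum_annihilator[of \<psi> \<Lambda> X])
    fix l x assume "l \<in> \<Lambda>" and x: "x \<in> carrier G"
    then obtain l' where l': "l' \<in> carrier G" "l = dot n l'" unfolding \<Lambda>_def by blast
    show "l x \<in> carrier R"
      using dot_closed[of l' n x, folded G_def] l' x by simp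
    show "l (x \<oplus>\<^bsub>G\<^esub> y) = l x \<oplus> l y" if "y \<in> carrier G" for y
      using dot_add_right[of l' n x y, folded G_def] l' x that by simp
    show "l (a \<odot>\<^bsub>G\<^esub> x) = a \<otimes> l x" if "a \<in> carrier R" for a
      using dot_smult_right[of l' n x a, folded G_def] l' x that by simp
  next
    show "card X / 2 \<le> cmod (\<Sum>x\<in>X. \<psi> (l x))" if "l \<in> \<Lambda>" for l
      using that unfolding \<Lambda>_def ch_def by blast
  qed (use V.finite_carrier \<psi>(1) X(1) \<open>X \<noteq> {}\<close> in auto)
  have WG: "W \<subseteq> carrier G"
    using W(1) unfolding subspace_def by (blast dest: submodule.subset)
  obtain cc where cc: "(\<Sum>l\<in>carrier G. cmod (cc l)) \<le> 1 / \<alpha>"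
    and H: "\<And>x. x \<in> carrier G \<Longrightarrow> H x = (\<Sum>l\<in>carrier G. cc l * ch l x)"
    using V.average_fourier_expansion[OF ch orth \<alpha>(1) A M L] unfolding H_def by blast
  show thesis
  proof (rule that[OF W(1)])
    \<comment> \<open>The factor 2 lost in the size of \<open>X\<close> is absorbed by 2 <= 2^k, as
      k is positive.\<close>
    have "real ?N / card X \<le> 2 / \<alpha> ^ k" using X(2) cX \<alpha> by (simp add: field_simps)
    also have "\<dots> \<le> 2 ^ k / \<alpha> ^ k"
      using k \<alpha> by (intro divide_right_mono self_le_power) auto
    also have "\<dots> = (2 / \<alpha>) ^ k" by (simp add: power_divide)
    finally have "ln (real ?N / card X) \<le> ln ((2 / \<alpha>) ^ k)"
      using cX V.card_carrier_pos \<alpha> by (subst ln_le_cancel_iff) auto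
    also have "\<dots> = k * ln (2 / \<alpha>)" using \<alpha> by (simp add: ln_realpow)
    finally show "codim R G W \<le> 262144 * (1 / \<epsilon>\<^sup>2) * (ln (2 / (\<epsilon> * \<alpha>)))\<^sup>2 * (ln (2 / \<alpha>))\<^sup>2"
      using W(2) final by linarith
  next
    fix x t assume x: "x \<in> carrier G" and t: "t \<in> W"
    then have tG: "t \<in> carrier G" using WG by blast
    have "cmod (H (x \<oplus>\<^bsub>G\<^esub> t) - H x) \<le> 2 * real m * (2 * \<delta>) + 2 * (1 / \<alpha>) * (1 / 4) ^ m"
    proof (rule V.almost_period_annihilator[OF ch cc X(1) \<open>X \<noteq> {}\<close> H _ tG _ x])
      show "cmod (H (y \<oplus>\<^bsub>G\<^esub> s \<ominus>\<^bsub>G\<^esub> u) - H y) \<le> 2 * \<delta>" if "y \<in> carrier G" "s \<in> X" "u \<in> X" for y s u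
        using period[OF that] by (simp add: H_of_real flip: of_real_diff)
      show "ch l t = 1" if "l \<in> carrier G" "card X / 2 \<le> cmod (\<Sum>x\<in>X. ch l x)" for l
        using ann[of "dot n l" t] t that by (auto simp: \<Lambda>_def ch_def)
    qed
    also note m
    finally have "cmod (H (x \<oplus>\<^bsub>G\<^esub> t) - H x) \<le> \<epsilon>" .
    moreover have "T A M L (x \<oplus>\<^bsub>G\<^esub> t) - T A M L x = of_real (card A * card M) * (H (x \<oplus>\<^bsub>G\<^esub> t) - H x)"
      using x tG by (simp add: T right_diff_distrib)
    ultimately show "cmod (T A M L (x \<oplus>\<^bsub>G\<^esub> t) - T A M L x) \<le> \<epsilon> * card A * card M"
      using pos by (simp add: norm_mult mult_ac)
  qed
qed

theorem theorem3p2: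
  shows "\<exists>C::real. C > 0 \<and>
    (\<forall>(\<epsilon>::real) (\<alpha>::real) (q::nat) (n::nat) (F::nat ring)
       (A::(nat \<Rightarrow> nat) set) (M::(nat \<Rightarrow> nat) set) (L::(nat \<Rightarrow> nat) set).
      let G = coord_space F n;
          T = convolution G (convolution G (ind A) (ind M)) (ind L)
      in
        0 < \<epsilon> \<and> \<epsilon> < 1 \<and> 0 < \<alpha> \<and> \<alpha> \<le> 1 \<and>
        primepow q \<and> field F \<and> card (carrier F) = q \<and>
        A \<subseteq> carrier G \<and> M \<subseteq> carrier G \<and> L \<subseteq> carrier G \<and>
        density G A \<ge> \<alpha> \<and> density G M \<ge> \<alpha> \<longrightarrow>
        (\<exists>V. subspace F V G \<and>
           real_of_int (codim F G V) \<le> C * (1 / \<epsilon>\<^sup>2) * (ln (2 / (\<epsilon> * \<alpha>)))\<^sup>2 * (ln (2 / \<alpha>))\<^sup>2 \<and>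
           (\<forall>x\<in>carrier G. \<forall>t\<in>V.
              cmod (T (x \<oplus>\<^bsub>G\<^esub> t) - T x) \<le> \<epsilon> * real (card A) * real (card M)) \<and>
           cmod (T \<zero>\<^bsub>G\<^esub> - convolution G T (uniform_weight V) \<zero>\<^bsub>G\<^esub>)
             \<le> \<epsilon> * real (card A) * real (card M)))"
proof (intro exI[of _ "262144 :: real"] conjI allI)
  fix \<epsilon> \<alpha> :: real and q n :: nat and F :: "nat ring" and A M L :: "(nat \<Rightarrow> nat) set"
  define G where "G = coord_space F n"
  define T where "T = convolution G (convolution G (ind A) (ind M)) (ind L)"
  show "let G = coord_space F n;
          T = convolution G (convolution G (ind A) (ind M)) (ind L)
      in
        0 < \<epsilon> \<and> \<epsilon> < 1 \<and> 0 < \<alpha> \<and> \<alpha> \<le> 1 \<and>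
        primepow q \<and> field F \<and> card (carrier F) = q \<and>
        A \<subseteq> carrier G \<and> M \<subseteq> carrier G \<and> L \<subseteq> carrier G \<and>
        density G A \<ge> \<alpha> \<and> density G M \<ge> \<alpha> \<longrightarrow>
        (\<exists>V. subspace F V G \<and>
           real_of_int (codim F G V) \<le> 262144 * (1 / \<epsilon>\<^sup>2) * (ln (2 / (\<epsilon> * \<alpha>)))\<^sup>2 * (ln (2 / \<alpha>))\<^sup>2 \<and>
           (\<forall>x\<in>carrier G. \<forall>t\<in>V.
              cmod (T (x \<oplus>\<^bsub>G\<^esub> t) - T x) \<le> \<epsilon> * real (card A) * real (card M)) \<and>
           cmod (T \<zero>\<^bsub>G\<^esub> - convolution G T (uniform_weight V) \<zero>\<^bsub>G\<^esub>)
             \<le> \<epsilon> * real (card A) * real (card M))"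
    unfolding Let_def G_def[symmetric] T_def[symmetric]
  proof (intro impI, elim conjE)
    assume \<epsilon>: "0 < \<epsilon>" "\<epsilon> < 1" and \<alpha>: "0 < \<alpha>" "\<alpha> \<le> 1"
      and q: "primepow q" "card (carrier F) = q" and "field F"
      and sub: "A \<subseteq> carrier G" "M \<subseteq> carrier G" "L \<subseteq> carrier G"
      and dens: "\<alpha> \<le> density G A" "\<alpha> \<le> density G M"
    interpret field F by fact
    \<comment> \<open>An infinite carrier would have cardinality 0, which is not a prime
      power.\<close>
    have "card (carrier F) > 0" using q primepow_gt_Suc_0[of q] by simp
    then have fin: "finite (carrier F)" by (simp add: card_gt_0_iff)
    interpret V: module F G unfolding G_def by (rule func_space_is_module)
    interpret V: finite_abelian_group G
      by unfold_locales (use fin in \<open>auto simp: G_def coord_space_simps finite_PiE\<close>)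
    have card: "\<alpha> * card (carrier G) \<le> card A" "\<alpha> * card (carrier G) \<le> card M"
      using dens V.card_carrier_pos by (auto simp: density_def field_simps)
    obtain W where W: "subspace F W G"
      "codim F G W \<le> 262144 * (1 / \<epsilon>\<^sup>2) * (ln (2 / (\<epsilon> * \<alpha>)))\<^sup>2 * (ln (2 / \<alpha>))\<^sup>2"
      and near: "\<And>x t. x \<in> carrier G \<Longrightarrow> t \<in> W \<Longrightarrow> cmod (T (x \<oplus>\<^bsub>G\<^esub> t) - T x) \<le> \<epsilon> * card A * card M"
      using almost_periodicity_coord_space[OF fin \<epsilon> \<alpha>, of A n M L] sub card
      unfolding G_def T_def by blast
    have subm: "submodule F W G" using W(1) by (simp add: subspace_def)
    have WG: "W \<subseteq> carrier G" using subm by (rule submodule.subset)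
    \<comment> \<open>Symmetry of the subspace, as required for averaging over it at zero.\<close>
    have neg: "\<ominus>\<^bsub>G\<^esub> y \<in> W" if "y \<in> W" for y
    proof -
      have "(\<ominus>\<^bsub>F\<^esub> \<one>\<^bsub>F\<^esub>) \<odot>\<^bsub>G\<^esub> y = \<ominus>\<^bsub>G\<^esub> y" using that WG by (subst V.smult_l_minus) auto
      then show ?thesis using submodule.smult_closed[OF subm _ that, of "\<ominus>\<^bsub>F\<^esub> \<one>\<^bsub>F\<^esub>"] by simp
    qed
    have "W \<noteq> {}" using submodule.zero_closed[OF subm] by blast
    have "cmod (T \<zero>\<^bsub>G\<^esub> - convolution G T (uniform_weight W) \<zero>\<^bsub>G\<^esub>) \<le> \<epsilon> * card A * card M"
    proof (rule V.uniform_average_near[OF WG \<open>W \<noteq> {}\<close> neg])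
      show "cmod (T t - T \<zero>\<^bsub>G\<^esub>) \<le> \<epsilon> * card A * card M" if "t \<in> W" for t
        using near[OF V.zero_closed that] that WG by (simp add: subset_iff)
    qed
    then show "\<exists>V. subspace F V G \<and>
           real_of_int (codim F G V) \<le> 262144 * (1 / \<epsilon>\<^sup>2) * (ln (2 / (\<epsilon> * \<alpha>)))\<^sup>2 * (ln (2 / \<alpha>))\<^sup>2 \<and>
           (\<forall>x\<in>carrier G. \<forall>t\<in>V.
              cmod (T (x \<oplus>\<^bsub>G\<^esub> t) - T x) \<le> \<epsilon> * real (card A) * real (card M)) \<and>
           cmod (T \<zero>\<^bsub>G\<^esub> - convolution G T (uniform_weight V) \<zero>\<^bsub>G\<^esub>)
             \<le> \<epsilon> * real (card A) * real (card M)"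
      using W near by blast
  qed
qed simp

end
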